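(* There is a one-to-one correspondence between matched pairs of 3-Lie algebras and strict twilled 3-Lie algebras.
   Context: All vector spaces are finite-dimensional over an algebraically closed field of characteristic $0$. **3-Lie algebra.** A vector space with a skew-symmetric trilinear bracket satisfying $[x_1,x_2,[x_3,x_4,x_5]]=[[x_1,x_2,x_3],x_4,x_5]+[x_3,[x_1,x_2,x_4],x_5]+[x_3,x_4,[x_1,x_2,x_5]]$. **Representation.** A representation of a 3-Lie algebra $\mathfrak g$ on a vector space $V$ is a linear map $\rho:\wedge^2\mathfrak g\to\mathfrak{gl}(V)$ such that for all $x_1,x_2,x_3,x_4\in\mathfrak g$: $\rho(x_1,x_2)\rho(x_3,x_4)=\rho([x_1,x_2,x_3],x_4)+\rho(x_3,[x_1,x_2,x_4])+\rho(x_3,x_4)\rho(x_1,x_2)$ and $\rho(x_1,[x_2,x_3,x_4])=\rho(x_3,x_4)\rho(x_1,x_2)-\rho(x_2,x_4)\rho(x_1,x_3)+\rho(x_2,x_3)\rho(x_1,x_4)$. **Matched pair.** A matched pair of 3-Lie algebras is $(\mathfrak g_1,\mathfrak g_2;\rho,\mu)$ where $(\mathfrak g_1,[\cdot,\cdot,\cdot]_{\mathfrak g_1})$ and $(\mathfrak g_2,[\cdot,\cdot,\cdot]_{\mathfrak g_2})$ are 3-Lie algebras, $\rho:\wedge^2\mathfrak g_1\to\mathfrak{gl}(\mathfrak g_2)$ is a representation of $\mathfrak g_1$ on $\mathfrak g_2$, $\mu:\wedge^2\mathfrak g_2\to\mathfrak{gl}(\mathfrak g_1)$ is a representation of $\mathfrak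 g_2$ on $\mathfrak g_1$, and for all $x,y,z\in\mathfrak g_1$, $u,v,w\in\mathfrak g_2$: - $\mu(u,v)[x,y,z]_{\mathfrak g_1}=[\mu(u,v)x,y,z]_{\mathfrak g_1}+[x,\mu(u,v)y,z]_{\mathfrak g_1}+[x,y,\mu(u,v)z]_{\mathfrak g_1}$; - $[x,y,\mu(u,v)z]_{\mathfrak g_1}=\mu(\rho(x,y)u,v)z-\mu(\rho(x,z)v,u)y+\mu(\rho(y,z)v,u)x$; - $[\mu(u,v)x,y,z]_{\mathfrak g_1}=\mu(u,v)[x,y,z]_{\mathfrak g_1}+\mu(\rho(y,z)u,v)x+\mu(u,\rho(y,z)v)x$; - $\rho(x,y)[u,v,w]_{\mathfrak g_2}=[\rho(x,y)u,v,w]_{\mathfrak g_2}+[u,\rho(x,y)v,w]_{\mathfrak g_2}+[u,v,\rho(x,y)w]_{\mathfrak g_2}$; - $[u,v,\rho(x,y)w]_{\mathfrak g_2}=\rho(\mu(u,v)x,y)w-\rho(\mu(u,w)y,x)v+\rho(\mu(v,w)y,x)u$; - $[\rho(x,y)u,v,w]_{\mathfrak g_2}=\rho(x,y)[u,v,w]_{\mathfrak g_2}+\rho(\mu(v,w)x,y)u+\rho(x,\mu(v,w)y)u$. **Strict twilled 3-Lie algebra.** A twilled 3-Lie algebra is a triple $(\mathcal G,\mathfrak g_1,\mathfrak g_2)$ where $\mathcal G$ is a 3-Lie algebra, $\mathcal G=\mathfrak g_1\oplus\mathfrak g_2$ as vector spaces, and $\mathfrak g_1,\mathfrak g_2$ are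 subalgebras of $\mathcal G$. It is strict if $\psi=0$, where $\psi$ is the component of the bracket of $\mathcal G$ consisting of the $\mathfrak g_1$-projection of brackets of two elements of $\mathfrak g_1$ with one of $\mathfrak g_2$ and the $\mathfrak g_2$-projection of brackets of one element of $\mathfrak g_1$ with two of $\mathfrak g_2$; that is, $[\mathfrak g_1,\mathfrak g_1,\mathfrak g_2]_{\mathcal G}\subset\mathfrak g_2$ and $[\mathfrak g_1,\mathfrak g_2,\mathfrak g_2]_{\mathcal G}\subset\mathfrak g_1$. *)

theory Defs
  imports
    "HOL-Analysis.Product_Vector"
    "HOL-Library.FuncSet"
    "HOL-Computational_Algebra.Polynomial"
begin

text \<open>
  Every vector space occurring below is a finite-dimensional subspace of an ambient type, on which
  \<open>s\<close> is the scalar multiplication (\<open>vector_space s\<close> is assumed where needed). Working with carrier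
  sets lets the same notions apply to an internal summand of an algebra and to a whole type.
  Operations live in the function spaces \<open>\<rightarrow>\<^sub>E\<close> over their carriers, so that two structures are equal
  as soon as they have the same carriers and their operations agree on them.
\<close>

definition fd_subspace :: "('k::field \<Rightarrow> 'a::ab_group_add \<Rightarrow> 'a) \<Rightarrow> 'a set \<Rightarrow> bool" where
  "fd_subspace s V \<longleftrightarrow> module.subspace s V \<and> (\<exists>B. finite B \<and> module.span s B = V)"

definition lin_on ::
  "('k::field \<Rightarrow> 'a::ab_group_add \<Rightarrow> 'a) \<Rightarrow> ('k \<Rightarrow> 'b::ab_group_add \<Rightarrow> 'b) \<Rightarrow>
   'a set \<Rightarrow> ('a \<Rightarrow> 'b) \<Rightarrow> bool" where
  "lin_on s t V f \<longleftrightarrow>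
     (\<forall>x\<in>V. \<forall>y\<in>V. f (x + y) = f x + f y) \<and> (\<forall>c. \<forall>x\<in>V. f (s c x) = t c (f x))"

text \<open>\<open>trilin s t V W f\<close>: \<open>f\<close> is a trilinear map \<open>V \<times> V \<times> W \<rightarrow> W\<close>, equivalently a bilinear map
  from \<open>V \<times> V\<close> to the linear endomorphisms of \<open>W\<close>.\<close>

definition trilin ::
  "('k::field \<Rightarrow> 'a::ab_group_add \<Rightarrow> 'a) \<Rightarrow> ('k \<Rightarrow> 'b::ab_group_add \<Rightarrow> 'b) \<Rightarrow>
   'a set \<Rightarrow> 'b set \<Rightarrow> ('a \<Rightarrow> 'a \<Rightarrow> 'b \<Rightarrow> 'b) \<Rightarrow> bool" where
  "trilin s t V W f \<longleftrightarrow>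
     f \<in> V \<rightarrow>\<^sub>E V \<rightarrow>\<^sub>E W \<rightarrow>\<^sub>E W \<and>
     (\<forall>y\<in>V. \<forall>w\<in>W. lin_on s t V (\<lambda>x. f x y w)) \<and>
     (\<forall>x\<in>V. \<forall>w\<in>W. lin_on s t V (\<lambda>y. f x y w)) \<and>
     (\<forall>x\<in>V. \<forall>y\<in>V. lin_on t t W (\<lambda>w. f x y w))"


section \<open>3-Lie algebras and their representations\<close>

record 'a lie3 =
  sp :: "'a set"
  br :: "'a \<Rightarrow> 'a \<Rightarrow> 'a \<Rightarrow> 'a"

definition lie3_algebra :: "('k::field \<Rightarrow> 'a::ab_group_add \<Rightarrow> 'a) \<Rightarrow> 'a lie3 \<Rightarrow> bool" where
  "lie3_algebra s L \<longleftrightarrow>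
     fd_subspace s (sp L) \<and>
     trilin s s (sp L) (sp L) (br L) \<and>
     (\<forall>x\<in>sp L. \<forall>y\<in>sp L. \<forall>z\<in>sp L. br L x y z = - br L y x z \<and> br L x y z = - br L x z y) \<and>
     (\<forall>x1\<in>sp L. \<forall>x2\<in>sp L. \<forall>x3\<in>sp L. \<forall>x4\<in>sp L. \<forall>x5\<in>sp L.
        br L x1 x2 (br L x3 x4 x5) =
          br L (br L x1 x2 x3) x4 x5 + br L x3 (br L x1 x2 x4) x5 + br L x3 x4 (br L x1 x2 x5))"

definition lie3_subalgebra ::
  "('k::field \<Rightarrow> 'a::ab_group_add \<Rightarrow> 'a) \<Rightarrow> 'a lie3 \<Rightarrow> 'a set \<Rightarrow> bool" where
  "lie3_subalgebra s L V \<longleftrightarrow>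
     module.subspace s V \<and> V \<subseteq> sp L \<and> (\<forall>x\<in>V. \<forall>y\<in>V. \<forall>z\<in>V. br L x y z \<in> V)"

definition lie3_rep ::
  "('k::field \<Rightarrow> 'a::ab_group_add \<Rightarrow> 'a) \<Rightarrow> ('k \<Rightarrow> 'b::ab_group_add \<Rightarrow> 'b) \<Rightarrow>
   'a lie3 \<Rightarrow> 'b set \<Rightarrow> ('a \<Rightarrow> 'a \<Rightarrow> 'b \<Rightarrow> 'b) \<Rightarrow> bool" where
  "lie3_rep s t L V \<rho> \<longleftrightarrow>
     fd_subspace t V \<and>
     trilin s t (sp L) V \<rho> \<and>
     (\<forall>x\<in>sp L. \<forall>y\<in>sp L. \<forall>v\<in>V. \<rho> x y v = - \<rho> y x v) \<and>
     (\<forall>x1\<in>sp L. \<forall>x2\<in>sp L. \<forall>x3\<in>sp L. \<forall>x4\<in>sp L. \<forall>v\<in>V.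
        \<rho> x1 x2 (\<rho> x3 x4 v) =
          \<rho> (br L x1 x2 x3) x4 v + \<rho> x3 (br L x1 x2 x4) v + \<rho> x3 x4 (\<rho> x1 x2 v)) \<and>
     (\<forall>x1\<in>sp L. \<forall>x2\<in>sp L. \<forall>x3\<in>sp L. \<forall>x4\<in>sp L. \<forall>v\<in>V.
        \<rho> x1 (br L x2 x3 x4) v =
          \<rho> x3 x4 (\<rho> x1 x2 v) - \<rho> x2 x4 (\<rho> x1 x3 v) + \<rho> x2 x3 (\<rho> x1 x4 v))"


section \<open>Matched pairs\<close>

record ('a, 'b) lie3_pair =
  alg1 :: "'a lie3"
  alg2 :: "'b lie3"
  rho :: "'a \<Rightarrow> 'a \<Rightarrow> 'b \<Rightarrow> 'b"
  mu :: "'b \<Rightarrow> 'b \<Rightarrow> 'a \<Rightarrow> 'a"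

definition half_compatible ::
  "'a::ab_group_add lie3 \<Rightarrow> 'b::ab_group_add set \<Rightarrow>
   ('a \<Rightarrow> 'a \<Rightarrow> 'b \<Rightarrow> 'b) \<Rightarrow> ('b \<Rightarrow> 'b \<Rightarrow> 'a \<Rightarrow> 'a) \<Rightarrow> bool" where
  "half_compatible L V \<rho> \<mu> \<longleftrightarrow>
     (\<forall>x\<in>sp L. \<forall>y\<in>sp L. \<forall>z\<in>sp L. \<forall>u\<in>V. \<forall>v\<in>V.
        \<mu> u v (br L x y z) = br L (\<mu> u v x) y z + br L x (\<mu> u v y) z + br L x y (\<mu> u v z) \<and>
        br L x y (\<mu> u v z) = \<mu> (\<rho> x y u) v z - \<mu> (\<rho> x z v) u y + \<mu> (\<rho> y z v) u x \<and>
        br L (\<mu> u v x) y z = \<mu> u v (br L x y z) + \<mu> (\<rho> y z u) v x + \<mu> u (\<rho> y z v) x)"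

text \<open>The six compatibility conditions of a matched pair are three conditions together with their
  images under the exchange of the two algebras (and of \<open>\<rho>\<close> and \<open>\<mu>\<close>).\<close>

definition matched_pair ::
  "('k::field \<Rightarrow> 'a::ab_group_add \<Rightarrow> 'a) \<Rightarrow> ('k \<Rightarrow> 'b::ab_group_add \<Rightarrow> 'b) \<Rightarrow>
   ('a, 'b) lie3_pair \<Rightarrow> bool" where
  "matched_pair s t M \<longleftrightarrow>
     lie3_algebra s (alg1 M) \<and> lie3_algebra t (alg2 M) \<and>
     lie3_rep s t (alg1 M) (sp (alg2 M)) (rho M) \<and>
     lie3_rep t s (alg2 M) (sp (alg1 M)) (mu M) \<and>
     half_compatible (alg1 M) (sp (alg2 M)) (rho M) (mu M) \<and>
     half_compatible (alg2 M) (sp (alg1 M)) (mu M) (rho M)"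

definition matched_pair_iso ::
  "('k::field \<Rightarrow> 'a::ab_group_add \<Rightarrow> 'a) \<Rightarrow> ('k \<Rightarrow> 'b::ab_group_add \<Rightarrow> 'b) \<Rightarrow>
   ('k \<Rightarrow> 'c::ab_group_add \<Rightarrow> 'c) \<Rightarrow> ('k \<Rightarrow> 'd::ab_group_add \<Rightarrow> 'd) \<Rightarrow>
   ('a \<Rightarrow> 'c) \<Rightarrow> ('b \<Rightarrow> 'd) \<Rightarrow> ('a, 'b) lie3_pair \<Rightarrow> ('c, 'd) lie3_pair \<Rightarrow> bool" where
  "matched_pair_iso s t s' t' f g M M' \<longleftrightarrow>
     (let A = sp (alg1 M); B = sp (alg2 M) in
       lin_on s s' A f \<and> bij_betw f A (sp (alg1 M')) \<and>
       lin_on t t' B g \<and> bij_betw g B (sp (alg2 M')) \<and>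
       (\<forall>x\<in>A. \<forall>y\<in>A. \<forall>z\<in>A. f (br (alg1 M) x y z) = br (alg1 M') (f x) (f y) (f z)) \<and>
       (\<forall>u\<in>B. \<forall>v\<in>B. \<forall>w\<in>B. g (br (alg2 M) u v w) = br (alg2 M') (g u) (g v) (g w)) \<and>
       (\<forall>x\<in>A. \<forall>y\<in>A. \<forall>u\<in>B. g (rho M x y u) = rho M' (f x) (f y) (g u)) \<and>
       (\<forall>u\<in>B. \<forall>v\<in>B. \<forall>x\<in>A. f (mu M u v x) = mu M' (g u) (g v) (f x)))"


section \<open>Twilled 3-Lie algebras\<close>

record 'a twilled =
  alg :: "'a lie3"
  part1 :: "'a set"
  part2 :: "'a set"

definition twilled_lie3 :: "('k::field \<Rightarrow> 'a::ab_group_add \<Rightarrow> 'a) \<Rightarrow> 'a twilled \<Rightarrow> bool" where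
  "twilled_lie3 s T \<longleftrightarrow>
     lie3_algebra s (alg T) \<and>
     lie3_subalgebra s (alg T) (part1 T) \<and> lie3_subalgebra s (alg T) (part2 T) \<and>
     part1 T \<inter> part2 T = {0} \<and> sp (alg T) = {x + u | x u. x \<in> part1 T \<and> u \<in> part2 T}"

definition pr1 :: "'a::ab_group_add twilled \<Rightarrow> 'a \<Rightarrow> 'a" where
  "pr1 T p = (THE x. x \<in> part1 T \<and> p - x \<in> part2 T)"

definition pr2 :: "'a::ab_group_add twilled \<Rightarrow> 'a \<Rightarrow> 'a" where
  "pr2 T p = (THE u. u \<in> part2 T \<and> p - u \<in> part1 T)"

definition twilled_psi :: "'a::ab_group_add twilled \<Rightarrow> 'a \<Rightarrow> 'a \<Rightarrow> 'a \<Rightarrow> 'a" where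
  "twilled_psi T p q r =
     (let b = br (alg T);
          x = pr1 T p; y = pr1 T q; z = pr1 T r;
          u = pr2 T p; v = pr2 T q; w = pr2 T r
      in pr1 T (b x y w + b x v z + b u y z) + pr2 T (b x v w + b u y w + b u v z))"

definition strict_twilled :: "('k::field \<Rightarrow> 'a::ab_group_add \<Rightarrow> 'a) \<Rightarrow> 'a twilled \<Rightarrow> bool" where
  "strict_twilled s T \<longleftrightarrow>
     twilled_lie3 s T \<and>
     (\<forall>p\<in>sp (alg T). \<forall>q\<in>sp (alg T). \<forall>r\<in>sp (alg T). twilled_psi T p q r = 0)"

text \<open>\<open>\<psi> = 0\<close> says that \<open>[g\<^sub>1, g\<^sub>1, g\<^sub>2] \<subseteq> g\<^sub>2\<close> and \<open>[g\<^sub>1, g\<^sub>2, g\<^sub>2] \<subseteq> g\<^sub>1\<close>.\<close>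

lemma strict_twilled_iff:
  assumes vs: "vector_space s" and T: "twilled_lie3 s T"
  shows "strict_twilled s T \<longleftrightarrow>
    (\<forall>x\<in>part1 T. \<forall>y\<in>part1 T. \<forall>u\<in>part2 T. br (alg T) x y u \<in> part2 T) \<and>
    (\<forall>x\<in>part1 T. \<forall>u\<in>part2 T. \<forall>v\<in>part2 T. br (alg T) x u v \<in> part1 T)"
proof -
  interpret vector_space s by (rule vs)
  define A B G b where "A = part1 T" and "B = part2 T" and "G = sp (alg T)" and "b = br (alg T)"
  note ABGb = A_def[symmetric] B_def[symmetric] G_def[symmetric] b_def[symmetric]
  have sA: "subspace A" and sB: "subspace B" and AB: "A \<inter> B = {0}"
    and G: "G = {x + u | x u. x \<in> A \<and> u \<in> B}" and AG: "A \<subseteq> G" and BG: "B \<subseteq> G"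
    and L: "lie3_algebra s (alg T)"
    using T by (auto simp: twilled_lie3_def lie3_subalgebra_def ABGb)
  have tri: "trilin s s G G b"
    and skew: "\<And>x y z. x \<in> G \<Longrightarrow> y \<in> G \<Longrightarrow> z \<in> G \<Longrightarrow> b x y z = - b y x z \<and> b x y z = - b x z y"
    using L unfolding lie3_algebra_def ABGb by blast+
  have bG: "b x y z \<in> G" if "x \<in> G" "y \<in> G" "z \<in> G" for x y z
    using tri that unfolding trilin_def by (meson PiE_mem)
  have zG: "0 \<in> G" using AG subspace_0[OF sA] by blast
  have sG: "\<And>x y z. x \<in> G \<Longrightarrow> y \<in> G \<Longrightarrow> z \<in> G \<Longrightarrow> b (x + 0) y z = b x y z + b 0 y z"
    and sG2: "\<And>x y z. x \<in> G \<Longrightarrow> y \<in> G \<Longrightarrow> z \<in> G \<Longrightarrow> b x (y + 0) z = b x y z + b x 0 z"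
    and sG3: "\<And>x y z. x \<in> G \<Longrightarrow> y \<in> G \<Longrightarrow> z \<in> G \<Longrightarrow> b x y (z + 0) = b x y z + b x y 0"
    using tri zG unfolding trilin_def lin_on_def by blast+
  have b0: "\<And>y z. y \<in> G \<Longrightarrow> z \<in> G \<Longrightarrow> b 0 y z = 0" "\<And>x z. x \<in> G \<Longrightarrow> z \<in> G \<Longrightarrow> b x 0 z = 0"
    "\<And>x y. x \<in> G \<Longrightarrow> y \<in> G \<Longrightarrow> b x y 0 = 0"
    using sG sG2 sG3 zG by (metis add.right_neutral add_cancel_right_right)+
  have pr: "pr1 T (x + u) = x" "pr2 T (x + u) = u" if xu: "x \<in> A" "u \<in> B" for x u
  proof -
    have uniq: "x' = x" "u' = u" if "x' + u' = x + u" "x' \<in> A" "u' \<in> B" for x' u'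
    proof -
      have "x' - x = u - u'" using that(1) by (simp add: algebra_simps)
      moreover have "x' - x \<in> A" "u - u' \<in> B"
        using that xu sA sB by (auto intro: subspace_diff)
      ultimately have "x' - x \<in> A \<inter> B" "u - u' \<in> A \<inter> B" by simp_all
      then have "x' - x = 0" "u - u' = 0" unfolding AB by blast+
      then show "x' = x" "u' = u" by auto
    qed
    show "pr1 T (x + u) = x" unfolding pr1_def ABGb
    proof (rule the_equality)
      show "x \<in> A \<and> x + u - x \<in> B" using xu by simp
      fix x' assume "x' \<in> A \<and> x + u - x' \<in> B"
      then show "x' = x" using uniq(1)[of x' "x + u - x'"] by simp
    qed
    show "pr2 T (x + u) = u" unfolding pr2_def ABGb
    proof (rule the_equality)
      show "u \<in> B \<and> x + u - u \<in> A" using xu by simp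
      fix u' assume "u' \<in> B \<and> x + u - u' \<in> A"
      then show "u' = u" using uniq(2)[of "x + u - u'" u'] by simp
    qed
  qed
  have zA: "0 \<in> A" and zB: "0 \<in> B" using sA sB subspace_0 by auto
  have prA: "pr1 T x = x" "pr2 T x = 0" if "x \<in> A" for x using pr[of x 0] that zB by auto
  have prB: "pr1 T u = 0" "pr2 T u = u" if "u \<in> B" for u using pr[of 0 u] that zA by auto
  have inB: "p \<in> B" if "p \<in> G" "pr1 T p = 0" for p
    using that pr(1) unfolding G by fastforce
  have inA: "p \<in> A" if "p \<in> G" "pr2 T p = 0" for p
    using that pr(2) unfolding G by fastforce
  let ?R = "(\<forall>x\<in>A. \<forall>y\<in>A. \<forall>u\<in>B. b x y u \<in> B) \<and> (\<forall>x\<in>A. \<forall>u\<in>B. \<forall>v\<in>B. b x u v \<in> A)"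
  have "(\<forall>p\<in>G. \<forall>q\<in>G. \<forall>r\<in>G. twilled_psi T p q r = 0) \<longleftrightarrow> ?R"
  proof
    assume psi: "\<forall>p\<in>G. \<forall>q\<in>G. \<forall>r\<in>G. twilled_psi T p q r = 0"
    show ?R
    proof (intro conjI ballI)
      fix x y u assume *: "x \<in> A" "y \<in> A" "u \<in> B"
      then have g: "x \<in> G" "y \<in> G" "u \<in> G" using AG BG by auto
      then have "twilled_psi T x y u = 0" using psi by blast
      then have "pr1 T (b x y u) = 0"
        using g * zG prA[OF zA] by (simp add: twilled_psi_def ABGb Let_def prA prB b0)
      then show "b x y u \<in> B" using inB bG g by blast
    next
      fix x u v assume *: "x \<in> A" "u \<in> B" "v \<in> B"
      then have g: "x \<in> G" "u \<in> G" "v \<in> G" using AG BG by auto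
      then have "twilled_psi T x u v = 0" using psi by blast
      then have "pr2 T (b x u v) = 0"
        using g * zG prA[OF zA] by (simp add: twilled_psi_def ABGb Let_def prA prB b0)
      then show "b x u v \<in> A" using inA bG g by blast
    qed
  next
    assume R: ?R
    show "\<forall>p\<in>G. \<forall>q\<in>G. \<forall>r\<in>G. twilled_psi T p q r = 0"
    proof (intro ballI)
      fix p q r assume "p \<in> G" "q \<in> G" "r \<in> G"
      then obtain x u y v z w where *: "p = x + u" "q = y + v" "r = z + w"
        "x \<in> A" "y \<in> A" "z \<in> A" "u \<in> B" "v \<in> B" "w \<in> B" unfolding G by blast
      then have g: "x \<in> G" "y \<in> G" "z \<in> G" "u \<in> G" "v \<in> G" "w \<in> G" using AG BG by auto
      have "b x v z = - b x z v" "b u y z = - b y u z" "b y u z = - b y z u"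
        using skew g by blast+
      then have "b x v z \<in> B" "b u y z \<in> B" "b x y w \<in> B"
        using R * subspace_neg[OF sB] by metis+
      then have 1: "b x y w + b x v z + b u y z \<in> B" by (intro subspace_add[OF sB])
      have "b u y w = - b y u w" "b u v z = - b u z v" "b u z v = - b z u v"
        using skew g by blast+
      then have "b x v w \<in> A" "b u y w \<in> A" "b u v z \<in> A"
        using R * subspace_neg[OF sA] by metis+
      then have 2: "b x v w + b u y w + b u v z \<in> A" by (intro subspace_add[OF sA])
      show "twilled_psi T p q r = 0"
        using * prB(1)[OF 1] prA(2)[OF 2] by (simp add: twilled_psi_def ABGb Let_def pr)
    qed
  qed
  then show ?thesis using T by (simp add: strict_twilled_def ABGb)
qed

definition twilled_iso ::
  "('k::field \<Rightarrow> 'a::ab_group_add \<Rightarrow> 'a) \<Rightarrow> ('k \<Rightarrow> 'b::ab_group_add \<Rightarrow> 'b) \<Rightarrow>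
   ('a \<Rightarrow> 'b) \<Rightarrow> 'a twilled \<Rightarrow> 'b twilled \<Rightarrow> bool" where
  "twilled_iso s t h T T' \<longleftrightarrow>
     (let G = sp (alg T) in
       lin_on s t G h \<and> bij_betw h G (sp (alg T')) \<and>
       h ` part1 T = part1 T' \<and> h ` part2 T = part2 T' \<and>
       (\<forall>p\<in>G. \<forall>q\<in>G. \<forall>r\<in>G. h (br (alg T) p q r) = br (alg T') (h p) (h q) (h r)))"


section \<open>The two constructions\<close>

definition double :: "('a::ab_group_add, 'b::ab_group_add) lie3_pair \<Rightarrow> ('a \<times> 'b) twilled" where
  "double M =
     (let A = sp (alg1 M); B = sp (alg2 M); \<rho> = rho M; \<mu> = mu M in
       \<lparr> alg = \<lparr> sp = A \<times> B,
                 br = (\<lambda>p\<in>A \<times> B. \<lambda>q\<in>A \<times> B. \<lambda>r\<in>A \<times> B.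
                   (case (p, q, r) of ((x, u), (y, v), (z, w)) \<Rightarrow>
                     (br (alg1 M) x y z + \<mu> u v z + \<mu> v w x + \<mu> w u y,
                      br (alg2 M) u v w + \<rho> x y w + \<rho> y z u + \<rho> z x v))) \<rparr>,
         part1 = A \<times> {0}, part2 = {0} \<times> B \<rparr>)"

definition split_pair :: "'a twilled \<Rightarrow> ('a, 'a) lie3_pair" where
  "split_pair T =
     (let A = part1 T; B = part2 T; b = br (alg T) in
       \<lparr> alg1 = \<lparr> sp = A, br = (\<lambda>x\<in>A. \<lambda>y\<in>A. \<lambda>z\<in>A. b x y z) \<rparr>,
         alg2 = \<lparr> sp = B, br = (\<lambda>u\<in>B. \<lambda>v\<in>B. \<lambda>w\<in>B. b u v w) \<rparr>,
         rho = (\<lambda>x\<in>A. \<lambda>y\<in>A. \<lambda>u\<in>B. b x y u),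
         mu = (\<lambda>u\<in>B. \<lambda>v\<in>B. \<lambda>x\<in>A. b u v x) \<rparr>)"

end

theory Submission
  imports Defs
begin

text \<open>
  Let \<open>G = A \<oplus> B\<close> be a vector space with a skew-symmetric trilinear bracket for which \<open>A\<close> and \<open>B\<close> are
  closed and \<open>[A, A, B] \<subseteq> B\<close>, \<open>[A, B, B] \<subseteq> A\<close>. By multilinearity and skew-symmetry the bracket amounts
  to four maps: its restrictions to \<open>A\<close> and to \<open>B\<close>, an action \<open>\<rho>(x, y) u = [x, y, u]\<close> of \<open>A\<close> on \<open>B\<close> and
  an action \<open>\<mu>(u, v) x = [u, v, x]\<close> of \<open>B\<close> on \<open>A\<close>. Conversely, four such maps assemble to a bracket, by
  the formula that defines the double. So before any identity is imposed, pairs of algebras acting on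
  each other and strictly graded brackets are the same data.

  What has to be seen is that the identities also match. The fundamental identity
  \<open>[x\<^sub>1, x\<^sub>2, [x\<^sub>3, x\<^sub>4, x\<^sub>5]] = [[x\<^sub>1, x\<^sub>2, x\<^sub>3], x\<^sub>4, x\<^sub>5] + [x\<^sub>3, [x\<^sub>1, x\<^sub>2, x\<^sub>4], x\<^sub>5] + [x\<^sub>3, x\<^sub>4, [x\<^sub>1, x\<^sub>2, x\<^sub>5]]\<close>
  is additive in each argument, so it need only be checked with every argument in \<open>A\<close> or in \<open>B\<close>. It is
  also invariant up to sign under permutations of \<open>x\<^sub>1, x\<^sub>2\<close> and of \<open>x\<^sub>3, x\<^sub>4, x\<^sub>5\<close>, so only the number of
  elements of \<open>B\<close> in either group matters. This leaves twelve cases, six of which arise from the other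
  six by exchanging \<open>A\<close> and \<open>B\<close> (\<open>fund_id_iff_halves\<close>). Writing \<open>A A | A A B\<close> for the types of the two
  groups of arguments, six representatives are the following conditions:

  \<^item> \<open>A A | A A A\<close>: the fundamental identity of \<open>A\<close>;
  \<^item> \<open>A A | A A B\<close> and \<open>A B | A A A\<close>: the two identities of a representation, for \<open>\<rho>\<close>;
  \<^item> \<open>B B | A A A\<close>, \<open>A B | A A B\<close> and \<open>A A | A B B\<close>: the three compatibility conditions of one half.

  Each of these is the identity itself after rotating the brackets cyclically; \<open>half_matched_iff\<close>
  records this. Hence a pair satisfies the matched pair conditions if and only if the corresponding
  graded bracket satisfies the fundamental identity (\<open>matched_pair_iff_strict_twilled\<close>). The rest is
  transport: between an external and an internal direct sum, along
  the coordinate embeddings and \<open>(x, u) \<mapsto> x + u\<close>, and, for isomorphisms, the observation that a map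
  preserving both summands is block diagonal.
\<close>


section \<open>Finite-dimensional subspaces and linear maps\<close>

lemma fd_subspace_closed:
  assumes "vector_space s" and V: "fd_subspace s V"
  shows fd_subspace_zero: "0 \<in> V"
    and fd_subspace_add: "x \<in> V \<Longrightarrow> y \<in> V \<Longrightarrow> x + y \<in> V"
    and fd_subspace_neg: "x \<in> V \<Longrightarrow> - x \<in> V"
    and fd_subspace_scale: "x \<in> V \<Longrightarrow> s c x \<in> V"
proof -
  interpret vector_space s by fact
  have "subspace V" using V by (simp add: fd_subspace_def)
  then show "0 \<in> V" "x \<in> V \<Longrightarrow> y \<in> V \<Longrightarrow> x + y \<in> V" "x \<in> V \<Longrightarrow> - x \<in> V" "x \<in> V \<Longrightarrow> s c x \<in> V"
    by (auto intro: subspace_0 subspace_add subspace_neg subspace_scale)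
qed

lemma fd_subspace_subset:
  assumes vs: "vector_space s" and V: "fd_subspace s V" and W: "module.subspace s W" "W \<subseteq> V"
  shows "fd_subspace s W"
proof -
  interpret vector_space s by (rule vs)
  obtain C where C: "finite C" "span C = V" using V by (auto simp: fd_subspace_def)
  obtain B where B: "B \<subseteq> W" "independent B" "W \<subseteq> span B" using maximal_independent_subset by blast
  have "finite B" using independent_span_bound[OF C(1) B(2)] B(1) W(2) C(2) by blast
  moreover have "span B = W" using B W(1) span_minimal by blast
  ultimately show ?thesis using W(1) by (auto simp: fd_subspace_def)
qed

lemma fd_subspace_sum:
  assumes vs: "vector_space s" and V: "fd_subspace s V" and W: "fd_subspace s W"
  shows "fd_subspace s {x + y | x y. x \<in> V \<and> y \<in> W}"
proof -
  interpret vector_space s by (rule vs)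
  obtain B C where B: "finite B" "span B = V" and C: "finite C" "span C = W"
    using V W by (auto simp: fd_subspace_def)
  have "span (B \<union> C) = {x + y | x y. x \<in> V \<and> y \<in> W}"
    unfolding span_Un B(2) C(2) ..
  moreover have "finite (B \<union> C)" using B C by blast
  ultimately show ?thesis
    unfolding fd_subspace_def by (metis subspace_span)
qed

lemma lin_on_add: "lin_on s t V f \<Longrightarrow> x \<in> V \<Longrightarrow> y \<in> V \<Longrightarrow> f (x + y) = f x + f y"
  by (simp add: lin_on_def)

lemma lin_on_scale: "lin_on s t V f \<Longrightarrow> x \<in> V \<Longrightarrow> f (s c x) = t c (f x)"
  by (simp add: lin_on_def)

lemma lin_on_zero:
  assumes "lin_on s t V f" "0 \<in> V"
  shows "f 0 = 0"
  using lin_on_add[OF assms(1), of 0 0] assms(2) by simp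

lemma lin_on_neg:
  assumes "lin_on s t V f" "0 \<in> V" "x \<in> V" "- x \<in> V"
  shows "f (- x) = - f x"
  using lin_on_add[OF assms(1), of x "- x"] lin_on_zero[OF assms(1,2)] assms(3,4)
  by (simp add: eq_neg_iff_add_eq_0 add.commute)

text \<open>The map is linear on \<open>V\<close> only and arbitrary elsewhere, so the induction over the span of a
  spanning set also has to carry membership in \<open>V\<close> along.\<close>

lemma fd_subspace_image:
  assumes vs: "vector_space s" and vt: "vector_space t"
    and V: "fd_subspace s V" and f: "lin_on s t V f"
  shows "fd_subspace t (f ` V)"
proof -
  interpret s: vector_space s by (rule vs)
  interpret t: vector_space t by (rule vt)
  obtain B where B: "finite B" "s.span B = V" using V by (auto simp: fd_subspace_def)
  have sV: "s.subspace V" using V by (simp add: fd_subspace_def)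
  have f0: "f 0 = 0" by (rule lin_on_zero[OF f s.subspace_0[OF sV]])
  have BV: "B \<subseteq> V" using B s.span_superset by blast
  have sub: "t.subspace (f ` V)"
  proof (rule t.subspaceI)
    show "0 \<in> f ` V" using f0 s.subspace_0[OF sV] by (metis imageI)
    show "x + y \<in> f ` V" if "x \<in> f ` V" "y \<in> f ` V" for x y
      using that f s.subspace_add[OF sV] by (auto simp flip: lin_on_add[OF f])
    show "t c x \<in> f ` V" if "x \<in> f ` V" for c x
      using that f s.subspace_scale[OF sV] by (auto simp flip: lin_on_scale[OF f])
  qed
  have "x \<in> V \<and> f x \<in> t.span (f ` B)" if "x \<in> s.span B" for x
    using that
  proof (induction rule: s.span_induct_alt)
    case base
    then show ?case by (simp add: f0 t.span_zero s.subspace_0[OF sV])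
  next
    case (step c x y)
    then have "x \<in> V" "y \<in> V" "f y \<in> t.span (f ` B)" "f x \<in> t.span (f ` B)"
      using BV t.span_base by blast+
    then show ?case
      by (simp add: lin_on_add[OF f] lin_on_scale[OF f] sV s.subspace_add s.subspace_scale
          t.span_add t.span_scale)
  qed
  then have "f ` V \<subseteq> t.span (f ` B)" using B by blast
  moreover have "t.span (f ` B) \<subseteq> f ` V"
    using BV sub by (intro t.span_minimal) auto
  ultimately show ?thesis
    using sub B(1) by (auto simp: fd_subspace_def)
qed


section \<open>Skew-symmetric ternary brackets and the fundamental identity\<close>

text \<open>The fundamental identity at one quintuple of arguments. It is kept pointwise because the whole
  proof consists in distributing its instances over the degrees of the five arguments.\<close>

definition fund_id :: "('g::plus \<Rightarrow> 'g \<Rightarrow> 'g \<Rightarrow> 'g) \<Rightarrow> 'g \<Rightarrow> 'g \<Rightarrow> 'g \<Rightarrow> 'g \<Rightarrow> 'g \<Rightarrow> bool" where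
  "fund_id b x1 x2 x3 x4 x5 \<longleftrightarrow>
     b x1 x2 (b x3 x4 x5) = b (b x1 x2 x3) x4 x5 + b x3 (b x1 x2 x4) x5 + b x3 x4 (b x1 x2 x5)"

text \<open>Additivity in the last slot and the two adjacent skew-symmetries give additivity in every slot.
  The fundamental identity involves only addition, so everything about it can be derived in this
  purely additive setting.\<close>

locale ternary_bracket =
  fixes G :: "'g::ab_group_add set" and b :: "'g \<Rightarrow> 'g \<Rightarrow> 'g \<Rightarrow> 'g"
  assumes zero: "0 \<in> G"
    and plus: "x \<in> G \<Longrightarrow> y \<in> G \<Longrightarrow> x + y \<in> G"
    and closed: "x \<in> G \<Longrightarrow> y \<in> G \<Longrightarrow> z \<in> G \<Longrightarrow> b x y z \<in> G"
    and neg: "x \<in> G \<Longrightarrow> - x \<in> G"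
    and add3: "x \<in> G \<Longrightarrow> y \<in> G \<Longrightarrow> z \<in> G \<Longrightarrow> z' \<in> G \<Longrightarrow> b x y (z + z') = b x y z + b x y z'"
    and skew12: "x \<in> G \<Longrightarrow> y \<in> G \<Longrightarrow> z \<in> G \<Longrightarrow> b x y z = - b y x z"
    and skew23: "x \<in> G \<Longrightarrow> y \<in> G \<Longrightarrow> z \<in> G \<Longrightarrow> b x y z = - b x z y"
begin

lemma rotate: "x \<in> G \<Longrightarrow> y \<in> G \<Longrightarrow> z \<in> G \<Longrightarrow> b x y z = b y z x"
  using skew12[of x y z] skew23[of y x z] by simp

lemma add1: "x \<in> G \<Longrightarrow> x' \<in> G \<Longrightarrow> y \<in> G \<Longrightarrow> z \<in> G \<Longrightarrow> b (x + x') y z = b x y z + b x' y z"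
  by (simp add: rotate[of _ y z] add3 plus)

lemma add2: "x \<in> G \<Longrightarrow> y \<in> G \<Longrightarrow> y' \<in> G \<Longrightarrow> z \<in> G \<Longrightarrow> b x (y + y') z = b x y z + b x y' z"
  using add3[of z x y y'] by (simp add: rotate[of z x] plus)

lemma zero3: "x \<in> G \<Longrightarrow> y \<in> G \<Longrightarrow> b x y 0 = 0"
  using add3[of x y 0 0] zero by simp

lemma neg3: "x \<in> G \<Longrightarrow> y \<in> G \<Longrightarrow> z \<in> G \<Longrightarrow> b x y (- z) = - b x y z"
  using add3[of x y z "- z"] zero3[of x y] neg[of z] by (simp add: eq_neg_iff_add_eq_0 add.commute)

lemma neg1: "x \<in> G \<Longrightarrow> y \<in> G \<Longrightarrow> z \<in> G \<Longrightarrow> b (- x) y z = - b x y z"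
  by (simp add: rotate[of _ y z] neg3 neg)

lemma neg2: "x \<in> G \<Longrightarrow> y \<in> G \<Longrightarrow> z \<in> G \<Longrightarrow> b x (- y) z = - b x y z"
  using neg3[of z x y] by (simp add: rotate[of z x] neg)

text \<open>The difference of the two sides of the fundamental identity changes sign when the first two
  arguments, or two of the last three, are exchanged. So whether the identity holds depends on the
  first two arguments as an unordered pair and on the last three as an unordered triple.\<close>

lemma fund_id_swap12:
  assumes "x1 \<in> G" "x2 \<in> G" "x3 \<in> G" "x4 \<in> G" "x5 \<in> G" "fund_id b x1 x2 x3 x4 x5"
  shows "fund_id b x2 x1 x3 x4 x5"
proof -
  have flip: "b x2 x1 z = - b x1 x2 z" if "z \<in> G" for z
    using skew12 assms(1,2) that by blast
  show ?thesis
    using assms by (simp add: fund_id_def flip closed neg1 neg2 neg3 algebra_simps)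
qed

lemma fund_id_swap34:
  assumes "x1 \<in> G" "x2 \<in> G" "x3 \<in> G" "x4 \<in> G" "x5 \<in> G" "fund_id b x1 x2 x3 x4 x5"
  shows "fund_id b x1 x2 x4 x3 x5"
proof -
  have "b x1 x2 (b x4 x3 x5) = - b x1 x2 (b x3 x4 x5)"
    using assms skew12[of x4 x3] by (simp add: closed neg3)
  moreover have "b (b x1 x2 x4) x3 x5 = - b x3 (b x1 x2 x4) x5"
    "b x4 (b x1 x2 x3) x5 = - b (b x1 x2 x3) x4 x5" "b x4 x3 (b x1 x2 x5) = - b x3 x4 (b x1 x2 x5)"
    by (rule skew12; simp add: assms(1-5) closed)+
  ultimately show ?thesis using assms(6) by (simp add: fund_id_def)
qed

lemma fund_id_swap45:
  assumes "x1 \<in> G" "x2 \<in> G" "x3 \<in> G" "x4 \<in> G" "x5 \<in> G" "fund_id b x1 x2 x3 x4 x5"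
  shows "fund_id b x1 x2 x3 x5 x4"
proof -
  have "b x1 x2 (b x3 x5 x4) = - b x1 x2 (b x3 x4 x5)"
    using assms skew23[of x3 x5 x4] by (simp add: closed neg3)
  moreover have "b x3 (b x1 x2 x5) x4 = - b x3 x4 (b x1 x2 x5)"
    "b (b x1 x2 x3) x5 x4 = - b (b x1 x2 x3) x4 x5" "b x3 x5 (b x1 x2 x4) = - b x3 (b x1 x2 x4) x5"
    by (rule skew23; simp add: assms(1-5) closed)+
  ultimately show ?thesis using assms(6) by (simp add: fund_id_def)
qed

lemma fund_id_add2:
  assumes "x1 \<in> G" "x2 \<in> G" "y2 \<in> G" "x3 \<in> G" "x4 \<in> G" "x5 \<in> G"
    "fund_id b x1 x2 x3 x4 x5" "fund_id b x1 y2 x3 x4 x5"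
  shows "fund_id b x1 (x2 + y2) x3 x4 x5"
  using assms by (simp add: fund_id_def add1 add2 add3 closed)

lemma fund_id_add5:
  assumes "x1 \<in> G" "x2 \<in> G" "x3 \<in> G" "x4 \<in> G" "x5 \<in> G" "y5 \<in> G"
    "fund_id b x1 x2 x3 x4 x5" "fund_id b x1 x2 x3 x4 y5"
  shows "fund_id b x1 x2 x3 x4 (x5 + y5)"
  using assms by (simp add: fund_id_def add1 add2 add3 closed)

end

text \<open>The elements of \<open>A\<close> and of \<open>B\<close> are called homogeneous below. The two sets enter symmetrically, so
  that whatever is derived about \<open>A\<close> and \<open>B\<close> may be used with them exchanged.\<close>

locale graded_bracket = ternary_bracket G b for G :: "'g::ab_group_add set" and b +
  fixes A B :: "'g set"
  assumes G_sum: "G = {x + u | x u. x \<in> A \<and> u \<in> B}"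
    and zeroA: "0 \<in> A" and zeroB: "0 \<in> B"
begin

lemma A_G: "x \<in> A \<Longrightarrow> x \<in> G"
  using G_sum zeroB by force

lemma B_G: "x \<in> B \<Longrightarrow> x \<in> G"
  using G_sum zeroA by force

text \<open>Multilinear expansion. The right-hand side groups the eight terms as in the bracket of the double
  of a matched pair: after a cyclic rotation, an action always appears with its two acting
  arguments first.\<close>

lemma bracket_sum:
  assumes "x \<in> A" "y \<in> A" "z \<in> A" "u \<in> B" "v \<in> B" "w \<in> B"
  shows "b (x + u) (y + v) (z + w) =
    (b x y z + b u v z + b v w x + b w u y) + (b u v w + b x y w + b y z u + b z x v)"
proof -
  note g = assms(1-3)[THEN A_G] assms(4-6)[THEN B_G]
  have "b (x + u) (y + v) (z + w) =
    b x y z + b x y w + b x v z + b x v w + b u y z + b u y w + b u v z + b u v w"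
    using g by (simp add: add1 add2 add3 plus algebra_simps)
  also have "b x v z = b z x v" using rotate[of z x v] g by simp
  also have "b x v w = b v w x" using rotate[of x v w] g by simp
  also have "b u y z = b y z u" using rotate[of u y z] g by simp
  also have "b u y w = b w u y" using rotate[of w u y] g by simp
  finally show ?thesis by (simp add: algebra_simps)
qed

text \<open>Both sides of the fundamental identity are additive in each argument, so it suffices to check it
  on homogeneous arguments. The arguments are released one at a time; by the symmetries above,
  additivity in the second and in the last slot is enough.\<close>

lemma fund_id_from_pure:
  assumes pure: "\<And>x1 x2 x3 x4 x5. x1 \<in> A \<union> B \<Longrightarrow> x2 \<in> A \<union> B \<Longrightarrow> x3 \<in> A \<union> B \<Longrightarrow> x4 \<in> A \<union> B \<Longrightarrow>
      x5 \<in> A \<union> B \<Longrightarrow> fund_id b x1 x2 x3 x4 x5"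
    and G: "x1 \<in> G" "x2 \<in> G" "x3 \<in> G" "x4 \<in> G" "x5 \<in> G"
  shows "fund_id b x1 x2 x3 x4 x5"
proof -
  let ?P = "A \<union> B"
  have P_G: "x \<in> G" if "x \<in> ?P" for x using that A_G B_G by blast
  have split: "\<exists>x\<in>?P. \<exists>u\<in>?P. p = x + u" if "p \<in> G" for p using that G_sum by blast
  have 5: "fund_id b x1 x2 x3 x4 p"
    if *: "x1 \<in> ?P" "x2 \<in> ?P" "x3 \<in> ?P" "x4 \<in> ?P" "p \<in> G" for x1 x2 x3 x4 p
  proof -
    obtain x u where p: "x \<in> ?P" "u \<in> ?P" "p = x + u" using split[OF *(5)] by blast
    show ?thesis unfolding p(3) using * p by (intro fund_id_add5 pure) (simp_all add: P_G)
  qed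
  have 4: "fund_id b x1 x2 x3 p x5"
    if *: "x1 \<in> ?P" "x2 \<in> ?P" "x3 \<in> ?P" "p \<in> G" "x5 \<in> G" for x1 x2 x3 p x5
  proof -
    obtain x u where p: "x \<in> ?P" "u \<in> ?P" "p = x + u" using split[OF *(4)] by blast
    have "fund_id b x1 x2 x3 x5 (x + u)"
      using * p by (intro fund_id_add5 fund_id_swap45[OF _ _ _ _ _ 5]) (simp_all add: P_G)
    then show ?thesis unfolding p(3) using * p by - (rule fund_id_swap45, simp_all add: P_G plus)
  qed
  have 3: "fund_id b x1 x2 p x4 x5"
    if *: "x1 \<in> ?P" "x2 \<in> ?P" "p \<in> G" "x4 \<in> G" "x5 \<in> G" for x1 x2 p x4 x5
  proof -
    obtain x u where p: "x \<in> ?P" "u \<in> ?P" "p = x + u" using split[OF *(3)] by blast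
    have last: "fund_id b x1 x2 x4 x5 y" if "y \<in> ?P" for y
      using * that
      by (intro fund_id_swap45[OF _ _ _ _ _ fund_id_swap34[OF _ _ _ _ _ 4]]) (simp_all add: P_G)
    have "fund_id b x1 x2 x4 x5 (x + u)"
      using * p by (intro fund_id_add5 last) (simp_all add: P_G)
    then show ?thesis unfolding p(3) using * p
      by - (rule fund_id_swap34[OF _ _ _ _ _ fund_id_swap45], simp_all add: P_G plus)
  qed
  have 2: "fund_id b x1 p x3 x4 x5"
    if *: "x1 \<in> ?P" "p \<in> G" "x3 \<in> G" "x4 \<in> G" "x5 \<in> G" for x1 p x3 x4 x5
  proof -
    obtain x u where p: "x \<in> ?P" "u \<in> ?P" "p = x + u" using split[OF *(2)] by blast
    show ?thesis unfolding p(3) using * p by (intro fund_id_add2 3) (simp_all add: P_G)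
  qed
  obtain x u where p: "x \<in> ?P" "u \<in> ?P" "x1 = x + u" using split[OF G(1)] by blast
  have "fund_id b x2 (x + u) x3 x4 x5"
    using G p by (intro fund_id_add2 fund_id_swap12[OF _ _ _ _ _ 2]) (simp_all add: P_G)
  then show ?thesis unfolding p(3) using G p by - (rule fund_id_swap12, simp_all add: P_G plus)
qed

end

text \<open>A permutation-invariant statement about three homogeneous elements depends only on how many of
  them lie in \<open>B\<close>.\<close>

lemma symmetric3_cases:
  assumes swap12: "\<And>x y z. x \<in> A \<union> B \<Longrightarrow> y \<in> A \<union> B \<Longrightarrow> z \<in> A \<union> B \<Longrightarrow> P x y z \<Longrightarrow> P y x z"
    and swap23: "\<And>x y z. x \<in> A \<union> B \<Longrightarrow> y \<in> A \<union> B \<Longrightarrow> z \<in> A \<union> B \<Longrightarrow> P x y z \<Longrightarrow> P x z y"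
    and cases: "\<And>x y z. x \<in> A \<Longrightarrow> y \<in> A \<Longrightarrow> z \<in> A \<Longrightarrow> P x y z"
      "\<And>x y u. x \<in> A \<Longrightarrow> y \<in> A \<Longrightarrow> u \<in> B \<Longrightarrow> P x y u"
      "\<And>u v x. u \<in> B \<Longrightarrow> v \<in> B \<Longrightarrow> x \<in> A \<Longrightarrow> P u v x"
      "\<And>u v w. u \<in> B \<Longrightarrow> v \<in> B \<Longrightarrow> w \<in> B \<Longrightarrow> P u v w"
    and xyz: "x \<in> A \<union> B" "y \<in> A \<union> B" "z \<in> A \<union> B"
  shows "P x y z"
proof -
  have ABA: "P x u y" if "x \<in> A" "y \<in> A" "u \<in> B" for x y u
    using swap23[OF _ _ _ cases(2)] that by blast
  have BAA: "P u x y" if "x \<in> A" "y \<in> A" "u \<in> B" for x y u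
    using swap12[OF _ _ _ ABA] that by blast
  have BAB: "P u x v" if "x \<in> A" "u \<in> B" "v \<in> B" for x u v
    using swap23[OF _ _ _ cases(3)] that by blast
  have ABB: "P x u v" if "x \<in> A" "u \<in> B" "v \<in> B" for x u v
    using swap12[OF _ _ _ BAB] that by blast
  show ?thesis
    using xyz by (elim UnE) (simp_all add: cases ABA BAA BAB ABB)
qed

section \<open>Matched pair conditions as graded components of the fundamental identity\<close>

text \<open>The instances of the fundamental identity that correspond to one half of the matched pair
  conditions. The arguments are ordered so that each instance turns directly into one of those
  conditions: the identity of the first algebra, the two identities of a representation, and the
  three compatibility conditions.\<close>

definition half_fund_id :: "('g::plus \<Rightarrow> 'g \<Rightarrow> 'g \<Rightarrow> 'g) \<Rightarrow> 'g set \<Rightarrow> 'g set \<Rightarrow> bool" where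
  "half_fund_id b A B \<longleftrightarrow>
     (\<forall>x1\<in>A. \<forall>x2\<in>A. \<forall>x3\<in>A. \<forall>x4\<in>A. \<forall>x5\<in>A. fund_id b x1 x2 x3 x4 x5) \<and>
     (\<forall>x1\<in>A. \<forall>x2\<in>A. \<forall>x3\<in>A. \<forall>x4\<in>A. \<forall>u\<in>B. fund_id b x1 x2 x3 x4 u) \<and>
     (\<forall>x1\<in>A. \<forall>x2\<in>A. \<forall>x3\<in>A. \<forall>x4\<in>A. \<forall>u\<in>B. fund_id b u x1 x2 x3 x4) \<and>
     (\<forall>x\<in>A. \<forall>y\<in>A. \<forall>z\<in>A. \<forall>u\<in>B. \<forall>v\<in>B.
        fund_id b u v x y z \<and> fund_id b z v x y u \<and> fund_id b y z u v x)"

text \<open>Up to the symmetries there are \<open>3 \<times> 4 = 12\<close> homogeneous types: zero, one or two elements of \<open>B\<close>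
  among the first two arguments, and zero to three among the last three. Six of them form
  \<open>half_fund_id b A B\<close>, and exchanging \<open>A\<close> and \<open>B\<close> produces exactly the other six.\<close>

lemma (in graded_bracket) fund_id_iff_halves:
  "(\<forall>x1\<in>G. \<forall>x2\<in>G. \<forall>x3\<in>G. \<forall>x4\<in>G. \<forall>x5\<in>G. fund_id b x1 x2 x3 x4 x5) \<longleftrightarrow>
   half_fund_id b A B \<and> half_fund_id b B A" (is "?all \<longleftrightarrow> ?halves")
proof
  assume ?all
  then show ?halves unfolding half_fund_id_def by (simp add: A_G B_G)
next
  assume ?halves
  then have hA: "half_fund_id b A B" and hB: "half_fund_id b B A" by blast+
  have P_G: "x \<in> G" if "x \<in> A \<union> B" for x using that A_G B_G by blast
  have last: "fund_id b x1 x2 x3 x4 x5"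
    if x: "x1 \<in> G" "x2 \<in> G" "x3 \<in> A \<union> B" "x4 \<in> A \<union> B" "x5 \<in> A \<union> B"
      and cases: "\<And>x y z. x \<in> A \<Longrightarrow> y \<in> A \<Longrightarrow> z \<in> A \<Longrightarrow> fund_id b x1 x2 x y z"
      "\<And>x y u. x \<in> A \<Longrightarrow> y \<in> A \<Longrightarrow> u \<in> B \<Longrightarrow> fund_id b x1 x2 x y u"
      "\<And>u v x. u \<in> B \<Longrightarrow> v \<in> B \<Longrightarrow> x \<in> A \<Longrightarrow> fund_id b x1 x2 u v x"
      "\<And>u v w. u \<in> B \<Longrightarrow> v \<in> B \<Longrightarrow> w \<in> B \<Longrightarrow> fund_id b x1 x2 u v w"
    for x1 x2 x3 x4 x5
    by (rule symmetric3_cases[where P = "fund_id b x1 x2", OF _ _ cases x(3-5)])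
      (auto intro: fund_id_swap34 fund_id_swap45 simp: P_G x(1,2))
  have AA: "fund_id b x1 x2 x3 x4 x5"
    if x: "x1 \<in> A" "x2 \<in> A" "x3 \<in> A \<union> B" "x4 \<in> A \<union> B" "x5 \<in> A \<union> B" for x1 x2 x3 x4 x5
    by (rule last[OF A_G A_G x(3-5)]) (use x(1,2) hA hB in \<open>auto simp: half_fund_id_def\<close>)
  have BB: "fund_id b x1 x2 x3 x4 x5"
    if x: "x1 \<in> B" "x2 \<in> B" "x3 \<in> A \<union> B" "x4 \<in> A \<union> B" "x5 \<in> A \<union> B" for x1 x2 x3 x4 x5
    by (rule last[OF B_G B_G x(3-5)]) (use x(1,2) hA hB in \<open>auto simp: half_fund_id_def\<close>)
  have AB: "fund_id b x1 x2 x3 x4 x5"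
    if x: "x1 \<in> A" "x2 \<in> B" "x3 \<in> A \<union> B" "x4 \<in> A \<union> B" "x5 \<in> A \<union> B" for x1 x2 x3 x4 x5
  proof (rule last[OF A_G B_G x(3-5)])
    fix x y z assume *: "x \<in> A" "y \<in> A" "z \<in> A"
    then have "fund_id b x2 x1 x y z" using hA x(1,2) by (auto simp: half_fund_id_def)
    then show "fund_id b x1 x2 x y z"
      by - (rule fund_id_swap12, simp_all add: A_G B_G x(1,2) *)
  next
    fix u v x assume *: "u \<in> B" "v \<in> B" "x \<in> A"
    then have "fund_id b x2 x1 u v x" using hB x(1,2) by (auto simp: half_fund_id_def)
    then show "fund_id b x1 x2 u v x"
      by - (rule fund_id_swap12, simp_all add: A_G B_G x(1,2) *)
  qed (use x(1,2) hA hB in \<open>auto simp: half_fund_id_def\<close>)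
  have BA: "fund_id b x2 x1 x3 x4 x5"
    if x: "x1 \<in> A" "x2 \<in> B" "x3 \<in> A \<union> B" "x4 \<in> A \<union> B" "x5 \<in> A \<union> B" for x1 x2 x3 x4 x5
    using AB[OF x] by - (rule fund_id_swap12, simp_all add: A_G B_G x P_G[OF x(3)] P_G[OF x(4)] P_G[OF x(5)])
  have "fund_id b x1 x2 x3 x4 x5"
    if "x1 \<in> A \<union> B" "x2 \<in> A \<union> B" "x3 \<in> A \<union> B" "x4 \<in> A \<union> B" "x5 \<in> A \<union> B" for x1 x2 x3 x4 x5
    using that(1,2) by (elim UnE) (simp_all only: AA AB BA BB that(3-5))
  then show ?all
    by (blast intro: fund_id_from_pure)
qed

context ternary_bracket
begin

text \<open>
  The next three equivalences hold for arbitrary elements, not only homogeneous ones: the second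
  representation identity and the last two compatibility conditions are the fundamental identity
  itself, with every bracket rotated into the form in which it is an action, and the terms moved to
  the other side.\<close>

lemma fund_id_as_rep:
  assumes g: "x1 \<in> G" "x2 \<in> G" "x3 \<in> G" "x4 \<in> G" "u \<in> G"
  shows "fund_id b u x1 x2 x3 x4 \<longleftrightarrow>
    b x1 (b x2 x3 x4) u = b x3 x4 (b x1 x2 u) - b x2 x4 (b x1 x3 u) + b x2 x3 (b x1 x4 u)"
proof -
  have inner: "b u x1 y = b x1 y u" if "y \<in> G" for y using rotate[of u x1 y] g that by simp
  have "b (b x1 x2 u) x3 x4 = b x3 x4 (b x1 x2 u)" using rotate[of "b x1 x2 u" x3 x4] g closed by simp
  moreover have "b x2 (b x1 x3 u) x4 = - b x2 x4 (b x1 x3 u)"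
    by (rule skew23; simp add: closed g)
  ultimately show ?thesis using g by (simp add: fund_id_def inner closed)
qed

lemma fund_id_as_mixed:
  assumes g: "x \<in> G" "y \<in> G" "z \<in> G" "u \<in> G" "v \<in> G"
  shows "fund_id b z v x y u \<longleftrightarrow>
    b x y (b u v z) = b (b x y u) v z - b (b x z v) u y + b (b y z v) u x"
proof -
  have "b z v (b x y u) = - b (b x y u) v z"
    using skew12[of z v "b x y u"] rotate[of "b x y u" v z] rotate[of v z "b x y u"] g by (simp add: closed)
  moreover have "b (b z v x) y u = - b (b x z v) u y"
    using rotate[of x z v] skew23[of "b x z v" y u] g by (simp add: closed)
  moreover have "b x (b z v y) u = b (b y z v) u x"
    using rotate[of y z v] rotate[of x "b y z v" u] g by (simp add: closed)
  moreover have "b x y (b z v u) = - b x y (b u v z)"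
    using skew12[of z v u] rotate[of u v z] rotate[of v z u] g by (simp add: closed neg3)
  ultimately show ?thesis by (auto simp: fund_id_def algebra_simps)
qed

lemma fund_id_as_derivation:
  assumes g: "x \<in> G" "y \<in> G" "z \<in> G" "u \<in> G" "v \<in> G"
  shows "fund_id b y z u v x \<longleftrightarrow>
    b (b u v x) y z = b u v (b x y z) + b (b y z u) v x + b u (b y z v) x"
proof -
  have "b (b u v x) y z = b y z (b u v x)" using rotate[of "b u v x" y z] g by (simp add: closed)
  moreover have "b y z x = b x y z" using rotate[of x y z] g by simp
  ultimately show ?thesis by (auto simp: fund_id_def algebra_simps)
qed

end

text \<open>The six conditions on a matched pair that concern one of the two algebras, with the fundamental
  identity and the representation identities stripped of their linearity requirements. Swapping the
  roles of the algebras and of the actions gives the other six.\<close>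

definition half_matched ::
  "'a::ab_group_add lie3 \<Rightarrow> 'b::ab_group_add set \<Rightarrow>
   ('a \<Rightarrow> 'a \<Rightarrow> 'b \<Rightarrow> 'b) \<Rightarrow> ('b \<Rightarrow> 'b \<Rightarrow> 'a \<Rightarrow> 'a) \<Rightarrow> bool" where
  "half_matched L V \<rho> \<mu> \<longleftrightarrow>
     (\<forall>x1\<in>sp L. \<forall>x2\<in>sp L. \<forall>x3\<in>sp L. \<forall>x4\<in>sp L. \<forall>x5\<in>sp L. fund_id (br L) x1 x2 x3 x4 x5) \<and>
     (\<forall>x1\<in>sp L. \<forall>x2\<in>sp L. \<forall>x3\<in>sp L. \<forall>x4\<in>sp L. \<forall>v\<in>V.
        \<rho> x1 x2 (\<rho> x3 x4 v) =
          \<rho> (br L x1 x2 x3) x4 v + \<rho> x3 (br L x1 x2 x4) v + \<rho> x3 x4 (\<rho> x1 x2 v)) \<and>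
     (\<forall>x1\<in>sp L. \<forall>x2\<in>sp L. \<forall>x3\<in>sp L. \<forall>x4\<in>sp L. \<forall>v\<in>V.
        \<rho> x1 (br L x2 x3 x4) v =
          \<rho> x3 x4 (\<rho> x1 x2 v) - \<rho> x2 x4 (\<rho> x1 x3 v) + \<rho> x2 x3 (\<rho> x1 x4 v)) \<and>
     half_compatible L V \<rho> \<mu>"

text \<open>
  The maps \<open>i\<close> and \<open>j\<close> embed the two spaces into \<open>G\<close> in such a way that the bracket of \<open>L\<close> and both
  actions become the bracket of \<open>G\<close>. Since they are injective, an equation may be tested
  after applying them, and there it is an instance of the fundamental identity. Keeping \<open>i\<close> and \<open>j\<close>
  general covers the coordinate embeddings into \<open>A \<times> B\<close> and the inclusions of internal summands at
  once.\<close>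

lemma (in ternary_bracket) half_matched_iff:
  fixes i :: "'a::ab_group_add \<Rightarrow> 'g" and j :: "'b::ab_group_add \<Rightarrow> 'g"
  assumes brG: "\<And>x y z. x \<in> sp L \<Longrightarrow> y \<in> sp L \<Longrightarrow> z \<in> sp L \<Longrightarrow> br L x y z \<in> sp L"
    and \<rho>V: "\<And>x y u. x \<in> sp L \<Longrightarrow> y \<in> sp L \<Longrightarrow> u \<in> V \<Longrightarrow> \<rho> x y u \<in> V"
    and \<mu>L: "\<And>u v x. u \<in> V \<Longrightarrow> v \<in> V \<Longrightarrow> x \<in> sp L \<Longrightarrow> \<mu> u v x \<in> sp L"
    and plusL: "\<And>x y. x \<in> sp L \<Longrightarrow> y \<in> sp L \<Longrightarrow> x + y \<in> sp L"
    and minusL: "\<And>x y. x \<in> sp L \<Longrightarrow> y \<in> sp L \<Longrightarrow> x - y \<in> sp L"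
    and plusV: "\<And>x y. x \<in> V \<Longrightarrow> y \<in> V \<Longrightarrow> x + y \<in> V"
    and minusV: "\<And>x y. x \<in> V \<Longrightarrow> y \<in> V \<Longrightarrow> x - y \<in> V"
    and i: "inj_on i (sp L)" "\<And>x y. x \<in> sp L \<Longrightarrow> y \<in> sp L \<Longrightarrow> i (x + y) = i x + i y"
      "\<And>x. x \<in> sp L \<Longrightarrow> i x \<in> G"
    and j: "inj_on j V" "\<And>u v. u \<in> V \<Longrightarrow> v \<in> V \<Longrightarrow> j (u + v) = j u + j v"
      "\<And>u. u \<in> V \<Longrightarrow> j u \<in> G"
    and hom: "\<And>x y z. x \<in> sp L \<Longrightarrow> y \<in> sp L \<Longrightarrow> z \<in> sp L \<Longrightarrow> i (br L x y z) = b (i x) (i y) (i z)"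
      "\<And>x y u. x \<in> sp L \<Longrightarrow> y \<in> sp L \<Longrightarrow> u \<in> V \<Longrightarrow> j (\<rho> x y u) = b (i x) (i y) (j u)"
      "\<And>u v x. u \<in> V \<Longrightarrow> v \<in> V \<Longrightarrow> x \<in> sp L \<Longrightarrow> i (\<mu> u v x) = b (j u) (j v) (i x)"
  shows "half_matched L V \<rho> \<mu> \<longleftrightarrow> half_fund_id b (i ` sp L) (j ` V)"
proof -
  have i_minus: "i (x - y) = i x - i y" if "x \<in> sp L" "y \<in> sp L" for x y
    using i(2)[OF minusL[OF that] that(2)] by (simp add: algebra_simps)
  have j_minus: "j (x - y) = j x - j y" if "x \<in> V" "y \<in> V" for x y
    using j(2)[OF minusV[OF that] that(2)] by (simp add: algebra_simps)
  have i_eq: "p = q \<longleftrightarrow> i p = i q" if "p \<in> sp L" "q \<in> sp L" for p q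
    using inj_on_eq_iff[OF i(1) that] by simp
  have j_eq: "p = q \<longleftrightarrow> j p = j q" if "p \<in> V" "q \<in> V" for p q
    using inj_on_eq_iff[OF j(1) that] by simp
  note closed' = brG \<rho>V \<mu>L plusL minusL plusV minusV
  note homs = hom i(2) j(2) i_minus j_minus
  have "fund_id (br L) x1 x2 x3 x4 x5 \<longleftrightarrow> fund_id b (i x1) (i x2) (i x3) (i x4) (i x5)"
    if "x1 \<in> sp L" "x2 \<in> sp L" "x3 \<in> sp L" "x4 \<in> sp L" "x5 \<in> sp L" for x1 x2 x3 x4 x5
    unfolding fund_id_def using that by (subst i_eq) (simp_all add: closed' homs)
  moreover have "\<rho> x1 x2 (\<rho> x3 x4 v) =
          \<rho> (br L x1 x2 x3) x4 v + \<rho> x3 (br L x1 x2 x4) v + \<rho> x3 x4 (\<rho> x1 x2 v) \<longleftrightarrow>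
        fund_id b (i x1) (i x2) (i x3) (i x4) (j v)"
    if "x1 \<in> sp L" "x2 \<in> sp L" "x3 \<in> sp L" "x4 \<in> sp L" "v \<in> V" for x1 x2 x3 x4 v
    unfolding fund_id_def using that by (subst j_eq) (simp_all add: closed' homs)
  moreover have "\<rho> x1 (br L x2 x3 x4) v =
          \<rho> x3 x4 (\<rho> x1 x2 v) - \<rho> x2 x4 (\<rho> x1 x3 v) + \<rho> x2 x3 (\<rho> x1 x4 v) \<longleftrightarrow>
        fund_id b (j v) (i x1) (i x2) (i x3) (i x4)"
    if "x1 \<in> sp L" "x2 \<in> sp L" "x3 \<in> sp L" "x4 \<in> sp L" "v \<in> V" for x1 x2 x3 x4 v
    using that by (subst j_eq) (simp_all add: closed' homs fund_id_as_rep i j)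
  moreover have "\<mu> u v (br L x y z) = br L (\<mu> u v x) y z + br L x (\<mu> u v y) z + br L x y (\<mu> u v z) \<longleftrightarrow>
        fund_id b (j u) (j v) (i x) (i y) (i z)"
    if "x \<in> sp L" "y \<in> sp L" "z \<in> sp L" "u \<in> V" "v \<in> V" for x y z u v
    unfolding fund_id_def using that by (subst i_eq) (simp_all add: closed' homs)
  moreover have "br L x y (\<mu> u v z) = \<mu> (\<rho> x y u) v z - \<mu> (\<rho> x z v) u y + \<mu> (\<rho> y z v) u x \<longleftrightarrow>
        fund_id b (i z) (j v) (i x) (i y) (j u)"
    if "x \<in> sp L" "y \<in> sp L" "z \<in> sp L" "u \<in> V" "v \<in> V" for x y z u v
    using that by (subst i_eq) (simp_all add: closed' homs fund_id_as_mixed i j)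
  moreover have "br L (\<mu> u v x) y z = \<mu> u v (br L x y z) + \<mu> (\<rho> y z u) v x + \<mu> u (\<rho> y z v) x \<longleftrightarrow>
        fund_id b (i y) (i z) (j u) (j v) (i x)"
    if "x \<in> sp L" "y \<in> sp L" "z \<in> sp L" "u \<in> V" "v \<in> V" for x y z u v
    using that by (subst i_eq) (simp_all add: closed' homs fund_id_as_derivation i j)
  ultimately show ?thesis
    by (simp add: half_matched_def half_compatible_def half_fund_id_def cong: ball_cong)
qed

section \<open>Structures without their identities\<close>

text \<open>Each structure is divided into its multilinear, skew-symmetric data (the four predicates below)
  and its identities. The data are easy to carry back and forth between the two sides; the
  identities are then compared all at once.\<close>

definition pre_lie3 :: "('k::field \<Rightarrow> 'a::ab_group_add \<Rightarrow> 'a) \<Rightarrow> 'a lie3 \<Rightarrow> bool" where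
  "pre_lie3 s L \<longleftrightarrow>
     fd_subspace s (sp L) \<and> trilin s s (sp L) (sp L) (br L) \<and>
     (\<forall>x\<in>sp L. \<forall>y\<in>sp L. \<forall>z\<in>sp L. br L x y z = - br L y x z \<and> br L x y z = - br L x z y)"

definition pre_rep ::
  "('k::field \<Rightarrow> 'a::ab_group_add \<Rightarrow> 'a) \<Rightarrow> ('k \<Rightarrow> 'b::ab_group_add \<Rightarrow> 'b) \<Rightarrow>
   'a set \<Rightarrow> 'b set \<Rightarrow> ('a \<Rightarrow> 'a \<Rightarrow> 'b \<Rightarrow> 'b) \<Rightarrow> bool" where
  "pre_rep s t V W f \<longleftrightarrow>
     trilin s t V W f \<and> (\<forall>x\<in>V. \<forall>y\<in>V. \<forall>w\<in>W. f x y w = - f y x w)"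

definition pre_matched ::
  "('k::field \<Rightarrow> 'a::ab_group_add \<Rightarrow> 'a) \<Rightarrow> ('k \<Rightarrow> 'b::ab_group_add \<Rightarrow> 'b) \<Rightarrow>
   ('a, 'b) lie3_pair \<Rightarrow> bool" where
  "pre_matched s t M \<longleftrightarrow>
     pre_lie3 s (alg1 M) \<and> pre_lie3 t (alg2 M) \<and>
     pre_rep s t (sp (alg1 M)) (sp (alg2 M)) (rho M) \<and>
     pre_rep t s (sp (alg2 M)) (sp (alg1 M)) (mu M)"

definition pre_twilled :: "('k::field \<Rightarrow> 'a::ab_group_add \<Rightarrow> 'a) \<Rightarrow> 'a twilled \<Rightarrow> bool" where
  "pre_twilled s T \<longleftrightarrow>
     pre_lie3 s (alg T) \<and>
     lie3_subalgebra s (alg T) (part1 T) \<and> lie3_subalgebra s (alg T) (part2 T) \<and>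
     part1 T \<inter> part2 T = {0} \<and> sp (alg T) = {x + u | x u. x \<in> part1 T \<and> u \<in> part2 T} \<and>
     (\<forall>x\<in>part1 T. \<forall>y\<in>part1 T. \<forall>u\<in>part2 T. br (alg T) x y u \<in> part2 T) \<and>
     (\<forall>x\<in>part1 T. \<forall>u\<in>part2 T. \<forall>v\<in>part2 T. br (alg T) x u v \<in> part1 T)"

lemma trilin_closed: "trilin s t V W f \<Longrightarrow> x \<in> V \<Longrightarrow> y \<in> V \<Longrightarrow> w \<in> W \<Longrightarrow> f x y w \<in> W"
  unfolding trilin_def by (meson PiE_mem)

lemma trilin_lin:
  assumes "trilin s t V W f"
  shows trilin_lin1: "y \<in> V \<Longrightarrow> w \<in> W \<Longrightarrow> lin_on s t V (\<lambda>x. f x y w)"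
    and trilin_lin2: "x \<in> V \<Longrightarrow> w \<in> W \<Longrightarrow> lin_on s t V (\<lambda>y. f x y w)"
    and trilin_lin3: "x \<in> V \<Longrightarrow> y \<in> V \<Longrightarrow> lin_on t t W (\<lambda>w. f x y w)"
  using assms by (simp_all add: trilin_def)

lemma trilin_zero:
  assumes f: "trilin s t V W f" and "0 \<in> V" "0 \<in> W"
  shows "y \<in> V \<Longrightarrow> w \<in> W \<Longrightarrow> f 0 y w = 0"
    and "x \<in> V \<Longrightarrow> w \<in> W \<Longrightarrow> f x 0 w = 0"
    and "x \<in> V \<Longrightarrow> y \<in> V \<Longrightarrow> f x y 0 = 0"
  using trilin_lin[OF f, THEN lin_on_zero] assms(2,3) by auto

lemma trilin_restrict: "trilin s t V W f \<Longrightarrow> (\<lambda>x\<in>V. \<lambda>y\<in>V. \<lambda>w\<in>W. f x y w) = f"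
  unfolding trilin_def by (auto simp: PiE_iff extensional_def restrict_def fun_eq_iff)

lemma trilin_eqI:
  assumes "trilin s t V W f" "trilin s' t' V W g"
    and "\<And>x y w. x \<in> V \<Longrightarrow> y \<in> V \<Longrightarrow> w \<in> W \<Longrightarrow> f x y w = g x y w"
  shows "f = g"
proof -
  have "(\<lambda>x\<in>V. \<lambda>y\<in>V. \<lambda>w\<in>W. f x y w) = (\<lambda>x\<in>V. \<lambda>y\<in>V. \<lambda>w\<in>W. g x y w)"
    by (intro restrict_ext assms(3))
  then show ?thesis
    by (simp only: trilin_restrict[OF assms(1)] trilin_restrict[OF assms(2)])
qed

text \<open>Pushing a trilinear map forward along surjections \<open>i\<close> and \<open>j\<close>. The equation for \<open>g\<close> with an
  unspecified \<open>g'\<close> only says that \<open>g\<close> takes the default value outside its carriers; on the carriers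
  \<open>g\<close> is determined by \<open>hom\<close>.\<close>

lemma trilin_image:
  assumes vs: "vector_space s" "vector_space t"
    and V: "fd_subspace s V" and W: "fd_subspace t W" and f: "trilin s t V W f"
    and i: "lin_on s s' V i" and j: "lin_on t t' W j"
    and g: "g = (\<lambda>x\<in>i ` V. \<lambda>y\<in>i ` V. \<lambda>w\<in>j ` W. g' x y w)"
    and hom: "\<And>x y w. x \<in> V \<Longrightarrow> y \<in> V \<Longrightarrow> w \<in> W \<Longrightarrow> g (i x) (i y) (j w) = j (f x y w)"
  shows "trilin s' t' (i ` V) (j ` W) g"
proof -
  note cl = fd_subspace_closed[OF vs(1) V] fd_subspace_closed[OF vs(2) W] trilin_closed[OF f]
  note flip = lin_on_add[OF i, symmetric] lin_on_add[OF j, symmetric]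
    lin_on_scale[OF i, symmetric] lin_on_scale[OF j, symmetric]
  have "g \<in> i ` V \<rightarrow>\<^sub>E i ` V \<rightarrow>\<^sub>E j ` W \<rightarrow>\<^sub>E j ` W"
  proof -
    have "g p q r \<in> j ` W" if "p \<in> i ` V" "q \<in> i ` V" "r \<in> j ` W" for p q r
      using that by (auto simp: hom cl)
    then show ?thesis by (subst g) (subst (asm) g, auto)
  qed
  moreover have "lin_on s' t' (i ` V) (\<lambda>p. g p q r)" if "q \<in> i ` V" "r \<in> j ` W" for q r
    using that trilin_lin1[OF f] unfolding lin_on_def
    by (auto simp: flip hom cl)
  moreover have "lin_on s' t' (i ` V) (\<lambda>q. g p q r)" if "p \<in> i ` V" "r \<in> j ` W" for p r
    using that trilin_lin2[OF f] unfolding lin_on_def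
    by (auto simp: flip hom cl)
  moreover have "lin_on t' t' (j ` W) (\<lambda>r. g p q r)" if "p \<in> i ` V" "q \<in> i ` V" for p q
    using that trilin_lin3[OF f] unfolding lin_on_def
    by (auto simp: flip hom cl)
  ultimately show ?thesis by (simp add: trilin_def)
qed

lemma pre_rep_image:
  assumes vs: "vector_space s" "vector_space t"
    and V: "fd_subspace s V" and W: "fd_subspace t W" and f: "pre_rep s t V W f"
    and i: "lin_on s s' V i" and j: "lin_on t t' W j"
    and g: "g = (\<lambda>x\<in>i ` V. \<lambda>y\<in>i ` V. \<lambda>w\<in>j ` W. g' x y w)"
    and hom: "\<And>x y w. x \<in> V \<Longrightarrow> y \<in> V \<Longrightarrow> w \<in> W \<Longrightarrow> g (i x) (i y) (j w) = j (f x y w)"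
  shows "pre_rep s' t' (i ` V) (j ` W) g"
proof -
  have f': "trilin s t V W f" and skew: "\<And>x y w. x \<in> V \<Longrightarrow> y \<in> V \<Longrightarrow> w \<in> W \<Longrightarrow> f x y w = - f y x w"
    using f unfolding pre_rep_def by blast+
  have j_neg: "j (- w) = - j w" if "w \<in> W" for w
    using lin_on_neg[OF j] fd_subspace_closed[OF vs(2) W] that by blast
  have "g p q r = - g q p r" if pqr: "p \<in> i ` V" "q \<in> i ` V" "r \<in> j ` W" for p q r
  proof -
    obtain x y w where *: "x \<in> V" "y \<in> V" "w \<in> W" and eq: "p = i x" "q = i y" "r = j w"
      using pqr by blast
    show ?thesis
      unfolding eq hom[OF *] hom[OF *(2,1,3)] skew[OF *]
      by (rule j_neg) (rule trilin_closed[OF f' *(2,1,3)])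
  qed
  then show ?thesis
    unfolding pre_rep_def
    by (intro conjI ballI trilin_image[OF vs V W f' i j, OF g hom])
qed

lemma pre_lie3_image:
  assumes vs: "vector_space s" "vector_space t"
    and L: "pre_lie3 s L" and f: "lin_on s t (sp L) f" and sp: "sp L' = f ` sp L"
    and g: "br L' = (\<lambda>x\<in>sp L'. \<lambda>y\<in>sp L'. \<lambda>z\<in>sp L'. g x y z)"
    and hom: "\<And>x y z. x \<in> sp L \<Longrightarrow> y \<in> sp L \<Longrightarrow> z \<in> sp L \<Longrightarrow> br L' (f x) (f y) (f z) = f (br L x y z)"
  shows "pre_lie3 t L'"
proof -
  have V: "fd_subspace s (sp L)" and tri: "trilin s s (sp L) (sp L) (br L)"
    and skew: "\<And>x y z. x \<in> sp L \<Longrightarrow> y \<in> sp L \<Longrightarrow> z \<in> sp L \<Longrightarrow>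
      br L x y z = - br L y x z \<and> br L x y z = - br L x z y"
    using L unfolding pre_lie3_def by blast+
  have f_neg: "f (- w) = - f w" if "w \<in> sp L" for w
    using lin_on_neg[OF f] fd_subspace_closed[OF vs(1) V] that by blast
  have "br L' p q r = - br L' q p r \<and> br L' p q r = - br L' p r q"
    if pqr: "p \<in> sp L'" "q \<in> sp L'" "r \<in> sp L'" for p q r
  proof -
    obtain x y z where *: "x \<in> sp L" "y \<in> sp L" "z \<in> sp L" and eq: "p = f x" "q = f y" "r = f z"
      using pqr unfolding sp by blast
    have "f (br L x y z) = f (- br L y x z)" "f (br L x y z) = f (- br L x z y)"
      by (rule arg_cong[of _ _ f], use skew[OF *] in blast)+
    then show ?thesis
      unfolding eq hom[OF *] hom[OF *(2,1,3)] hom[OF *(1,3,2)]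
        f_neg[OF trilin_closed[OF tri *(2,1,3)]] f_neg[OF trilin_closed[OF tri *(1,3,2)]] ..
  qed
  then show ?thesis
    unfolding pre_lie3_def
    by (intro conjI ballI fd_subspace_image[OF vs V f, folded sp]
        trilin_image[OF vs(1,1) V V tri f f, OF g[unfolded sp] hom, folded sp]) blast+
qed

text \<open>For a skew-symmetric bracket, linearity in the last argument gives linearity in the others by
  cyclic rotation.\<close>

lemma pre_lie3I:
  assumes vs: "vector_space s" and V: "fd_subspace s (sp L)"
    and ext: "br L = (\<lambda>x\<in>sp L. \<lambda>y\<in>sp L. \<lambda>z\<in>sp L. g x y z)"
    and closed: "\<And>x y z. x \<in> sp L \<Longrightarrow> y \<in> sp L \<Longrightarrow> z \<in> sp L \<Longrightarrow> br L x y z \<in> sp L"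
    and skew: "\<And>x y z. x \<in> sp L \<Longrightarrow> y \<in> sp L \<Longrightarrow> z \<in> sp L \<Longrightarrow> br L x y z = - br L y x z"
      "\<And>x y z. x \<in> sp L \<Longrightarrow> y \<in> sp L \<Longrightarrow> z \<in> sp L \<Longrightarrow> br L x y z = - br L x z y"
    and lin: "\<And>x y. x \<in> sp L \<Longrightarrow> y \<in> sp L \<Longrightarrow> lin_on s s (sp L) (\<lambda>z. br L x y z)"
  shows "pre_lie3 s L"
proof -
  have rot: "br L x y z = br L y z x" if "x \<in> sp L" "y \<in> sp L" "z \<in> sp L" for x y z
    using skew(1)[of x y z] skew(2)[of y x z] that by simp
  note cl = fd_subspace_closed[OF vs V]
  have lin1: "lin_on s s (sp L) (\<lambda>x. br L x y z)" if "y \<in> sp L" "z \<in> sp L" for y z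
    using lin[OF that] that by (simp add: lin_on_def rot[of _ y z] cl)
  have lin2: "lin_on s s (sp L) (\<lambda>y. br L x y z)" if "x \<in> sp L" "z \<in> sp L" for x z
    using lin[OF that(2,1)] that by (simp add: lin_on_def rot[of z x, symmetric] cl)
  have "br L \<in> sp L \<rightarrow>\<^sub>E sp L \<rightarrow>\<^sub>E sp L \<rightarrow>\<^sub>E sp L"
  proof -
    have "g x y z \<in> sp L" if "x \<in> sp L" "y \<in> sp L" "z \<in> sp L" for x y z
      using closed[OF that] by (subst (asm) ext) (simp add: that)
    then show ?thesis by (subst ext) auto
  qed
  then show ?thesis
    unfolding pre_lie3_def trilin_def by (intro conjI ballI V lin lin1 lin2 skew)
qed

lemma pre_lie3_ternary_bracket:
  assumes vs: "vector_space s" and L: "pre_lie3 s L"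
  shows "ternary_bracket (sp L) (br L)"
proof -
  have V: "fd_subspace s (sp L)" and tri: "trilin s s (sp L) (sp L) (br L)"
    and skew: "\<And>x y z. x \<in> sp L \<Longrightarrow> y \<in> sp L \<Longrightarrow> z \<in> sp L \<Longrightarrow>
      br L x y z = - br L y x z \<and> br L x y z = - br L x z y"
    using L unfolding pre_lie3_def by blast+
  note V_closed = fd_subspace_closed[OF vs V]
  show ?thesis
  proof
    fix x y z z' assume *: "x \<in> sp L" "y \<in> sp L" "z \<in> sp L"
    show "br L x y z = - br L y x z" "br L x y z = - br L x z y" using skew[OF *] by blast+
    show "br L x y z \<in> sp L" by (rule trilin_closed[OF tri *])
    show "br L x y (z + z') = br L x y z + br L x y z'" if "z' \<in> sp L"
      by (rule lin_on_add[OF trilin_lin3[OF tri *(1,2)] *(3) that])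
  qed (fact V_closed)+
qed

lemma matched_pair_iff_halves:
  "matched_pair s t M \<longleftrightarrow> pre_matched s t M \<and>
     half_matched (alg1 M) (sp (alg2 M)) (rho M) (mu M) \<and>
     half_matched (alg2 M) (sp (alg1 M)) (mu M) (rho M)"
  by (auto simp: matched_pair_def pre_matched_def half_matched_def pre_lie3_def pre_rep_def
      lie3_algebra_def lie3_rep_def fund_id_def)

lemma strict_twilled_iff_fund_id:
  assumes "vector_space s"
  shows "strict_twilled s T \<longleftrightarrow> pre_twilled s T \<and>
    (\<forall>x1\<in>sp (alg T). \<forall>x2\<in>sp (alg T). \<forall>x3\<in>sp (alg T). \<forall>x4\<in>sp (alg T). \<forall>x5\<in>sp (alg T).
       fund_id (br (alg T)) x1 x2 x3 x4 x5)"
proof -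
  have "twilled_lie3 s T \<longleftrightarrow> lie3_algebra s (alg T) \<and> lie3_subalgebra s (alg T) (part1 T) \<and>
      lie3_subalgebra s (alg T) (part2 T) \<and> part1 T \<inter> part2 T = {0} \<and>
      sp (alg T) = {x + u | x u. x \<in> part1 T \<and> u \<in> part2 T}"
    by (rule twilled_lie3_def)
  moreover have "lie3_algebra s (alg T) \<longleftrightarrow> pre_lie3 s (alg T) \<and>
    (\<forall>x1\<in>sp (alg T). \<forall>x2\<in>sp (alg T). \<forall>x3\<in>sp (alg T). \<forall>x4\<in>sp (alg T). \<forall>x5\<in>sp (alg T).
       fund_id (br (alg T)) x1 x2 x3 x4 x5)"
    by (simp add: lie3_algebra_def pre_lie3_def fund_id_def)
  ultimately show ?thesis
    using strict_twilled_iff[OF assms, of T] strict_twilled_def[of s T]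
    unfolding pre_twilled_def by argo
qed

lemma pre_twilled_graded_bracket:
  assumes vs: "vector_space s" and T: "pre_twilled s T"
  shows "graded_bracket (sp (alg T)) (br (alg T)) (part1 T) (part2 T)"
proof -
  interpret ternary_bracket "sp (alg T)" "br (alg T)"
    by (rule pre_lie3_ternary_bracket[OF vs]) (use T in \<open>simp only: pre_twilled_def\<close>)
  show ?thesis
    by unfold_locales (use T in \<open>auto simp: pre_twilled_def\<close>)
qed

text \<open>
  The heart of the correspondence. Whenever \<open>M\<close> is, up to isomorphism, the pair cut out of \<open>T\<close>, the
  twelve conditions on \<open>M\<close> are the twelve homogeneous types of the fundamental identity in \<open>T\<close>.
  Strictness of \<open>T\<close> is among the data: it is what makes the mixed brackets define actions.\<close>

lemma matched_pair_iff_strict_twilled: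
  assumes vs: "vector_space s" "vector_space t" "vector_space r"
    and M: "pre_matched s t M" and T: "pre_twilled r T"
    and iso: "matched_pair_iso s t r r i j M (split_pair T)"
  shows "matched_pair s t M \<longleftrightarrow> strict_twilled r T"
proof -
  interpret graded_bracket "sp (alg T)" "br (alg T)" "part1 T" "part2 T"
    by (rule pre_twilled_graded_bracket[OF vs(3) T])
  let ?A = "sp (alg1 M)" and ?B = "sp (alg2 M)"
  have bij: "inj_on i ?A" "inj_on j ?B" and img: "i ` ?A = part1 T" "j ` ?B = part2 T"
    using iso by (auto simp: matched_pair_iso_def split_pair_def Let_def bij_betw_def)
  have in1: "i x \<in> part1 T" if "x \<in> ?A" for x using img that by blast
  have in2: "j x \<in> part2 T" if "x \<in> ?B" for x using img that by blast
  have L: "fd_subspace s ?A" "trilin s s ?A ?A (br (alg1 M))" "trilin s t ?A ?B (rho M)"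
      "fd_subspace t ?B" "trilin t t ?B ?B (br (alg2 M))" "trilin t s ?B ?A (mu M)"
    using M by (auto simp: pre_matched_def pre_lie3_def pre_rep_def)
  have lin: "lin_on s r ?A i" "lin_on t r ?B j"
    using iso by (auto simp: matched_pair_iso_def Let_def)
  have hom: "x \<in> ?A \<Longrightarrow> y \<in> ?A \<Longrightarrow> z \<in> ?A \<Longrightarrow> i (br (alg1 M) x y z) = br (alg T) (i x) (i y) (i z)"
      "u \<in> ?B \<Longrightarrow> v \<in> ?B \<Longrightarrow> w \<in> ?B \<Longrightarrow> j (br (alg2 M) u v w) = br (alg T) (j u) (j v) (j w)"
      "x \<in> ?A \<Longrightarrow> y \<in> ?A \<Longrightarrow> u \<in> ?B \<Longrightarrow> j (rho M x y u) = br (alg T) (i x) (i y) (j u)"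
      "u \<in> ?B \<Longrightarrow> v \<in> ?B \<Longrightarrow> x \<in> ?A \<Longrightarrow> i (mu M u v x) = br (alg T) (j u) (j v) (i x)" for x y z u v w
    using iso in1 in2 by (auto simp: matched_pair_iso_def split_pair_def Let_def)
  have minus: "x \<in> ?A \<Longrightarrow> y \<in> ?A \<Longrightarrow> x - y \<in> ?A" "u \<in> ?B \<Longrightarrow> v \<in> ?B \<Longrightarrow> u - v \<in> ?B" for x y u v
    using fd_subspace_add[OF vs(1) L(1)] fd_subspace_neg[OF vs(1) L(1)]
      fd_subspace_add[OF vs(2) L(4)] fd_subspace_neg[OF vs(2) L(4)]
    by (metis add_uminus_conv_diff)+
  note facts = L(2,3,5,6)[THEN trilin_closed] fd_subspace_add[OF vs(1) L(1)] fd_subspace_add[OF vs(2) L(4)]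
    minus bij lin[THEN lin_on_add] hom A_G[OF in1] B_G[OF in2]
  have "half_matched (alg1 M) ?B (rho M) (mu M) \<longleftrightarrow>
      half_fund_id (br (alg T)) (i ` ?A) (j ` ?B)"
    by (rule half_matched_iff) (fact facts)+
  moreover have "half_matched (alg2 M) ?A (mu M) (rho M) \<longleftrightarrow>
      half_fund_id (br (alg T)) (j ` ?B) (i ` ?A)"
    by (rule half_matched_iff) (fact facts)+
  ultimately show ?thesis
    using M T by (simp add: matched_pair_iff_halves strict_twilled_iff_fund_id[OF vs(3)]
        fund_id_iff_halves img)
qed

section \<open>From matched pairs to twilled algebras and back\<close>

lemma vector_space_prodI: "vector_space s \<Longrightarrow> vector_space t \<Longrightarrow> vector_space_prod s t"
  by (simp add: vector_space_prod_def vector_space_pair_def)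

lemma prod_scale:
  assumes "vector_space s" "vector_space t"
  shows "module_prod.scale s t c (x, u) = (s c x, t c u)"
proof -
  interpret vector_space_prod s t using assms by (rule vector_space_prodI)
  show ?thesis by (rule scale_prod)
qed

lemma vector_space_prod_scale:
  assumes "vector_space s" "vector_space t"
  shows "vector_space (module_prod.scale s t)"
proof -
  interpret vector_space_prod s t using assms by (rule vector_space_prodI)
  show ?thesis by (rule p.vector_space_axioms)
qed

lemma lin_on_Pair:
  assumes "vector_space s" "vector_space t"
  shows "lin_on s (module_prod.scale s t) V (\<lambda>x. (x, 0))"
    and "lin_on t (module_prod.scale s t) W (\<lambda>u. (0, u))"
proof -
  interpret vector_space_prod s t using assms by (rule vector_space_prodI)
  show "lin_on s scale V (\<lambda>x. (x, 0))" "lin_on t scale W (\<lambda>u. (0, u))"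
    by (simp_all add: lin_on_def scale_prod)
qed

lemma lin_on_fst_snd:
  assumes "vector_space s" "vector_space t"
  shows "lin_on (module_prod.scale s t) s V fst" and "lin_on (module_prod.scale s t) t V snd"
proof -
  interpret vector_space_prod s t using assms by (rule vector_space_prodI)
  show "lin_on scale s V fst" "lin_on scale t V snd"
    by (simp_all add: lin_on_def scale_def)
qed

lemma fd_subspace_Times:
  assumes vs: "vector_space s" "vector_space t" and V: "fd_subspace s V" and W: "fd_subspace t W"
  shows "fd_subspace (module_prod.scale s t) (V \<times> W)"
proof -
  note vp = vector_space_prod_scale[OF vs]
  have "V \<times> W = {p + q | p q. p \<in> (\<lambda>x. (x, 0)) ` V \<and> q \<in> (\<lambda>u. (0, u)) ` W}"
    by force
  also have "fd_subspace (module_prod.scale s t) \<dots>"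
    by (intro fd_subspace_sum vp fd_subspace_image[OF vs(1) vp V] fd_subspace_image[OF vs(2) vp W]
        lin_on_Pair vs)
  finally show ?thesis .
qed

lemma double_sel:
  "sp (alg (double M)) = sp (alg1 M) \<times> sp (alg2 M)"
  "part1 (double M) = sp (alg1 M) \<times> {0}" "part2 (double M) = {0} \<times> sp (alg2 M)"
  by (simp_all add: double_def Let_def)

lemma double_br:
  assumes "x \<in> sp (alg1 M)" "y \<in> sp (alg1 M)" "z \<in> sp (alg1 M)"
    "u \<in> sp (alg2 M)" "v \<in> sp (alg2 M)" "w \<in> sp (alg2 M)"
  shows "br (alg (double M)) (x, u) (y, v) (z, w) =
    (br (alg1 M) x y z + mu M u v z + mu M v w x + mu M w u y,
     br (alg2 M) u v w + rho M x y w + rho M y z u + rho M z x v)"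
  using assms by (simp add: double_def Let_def)

lemma pre_matchedD:
  assumes "pre_matched s t M"
  shows "fd_subspace s (sp (alg1 M))" "fd_subspace t (sp (alg2 M))"
    and "trilin s s (sp (alg1 M)) (sp (alg1 M)) (br (alg1 M))"
    "trilin t t (sp (alg2 M)) (sp (alg2 M)) (br (alg2 M))"
    "trilin s t (sp (alg1 M)) (sp (alg2 M)) (rho M)"
    "trilin t s (sp (alg2 M)) (sp (alg1 M)) (mu M)"
  using assms by (simp_all only: pre_matched_def pre_lie3_def pre_rep_def)

lemma pre_matched_skew:
  assumes "pre_matched s t M"
  shows "x \<in> sp (alg1 M) \<Longrightarrow> y \<in> sp (alg1 M) \<Longrightarrow> z \<in> sp (alg1 M) \<Longrightarrow>
      br (alg1 M) x y z = - br (alg1 M) y x z"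
    "x \<in> sp (alg1 M) \<Longrightarrow> y \<in> sp (alg1 M) \<Longrightarrow> z \<in> sp (alg1 M) \<Longrightarrow>
      br (alg1 M) x y z = - br (alg1 M) x z y"
    "u \<in> sp (alg2 M) \<Longrightarrow> v \<in> sp (alg2 M) \<Longrightarrow> w \<in> sp (alg2 M) \<Longrightarrow>
      br (alg2 M) u v w = - br (alg2 M) v u w"
    "u \<in> sp (alg2 M) \<Longrightarrow> v \<in> sp (alg2 M) \<Longrightarrow> w \<in> sp (alg2 M) \<Longrightarrow>
      br (alg2 M) u v w = - br (alg2 M) u w v"
    "x \<in> sp (alg1 M) \<Longrightarrow> y \<in> sp (alg1 M) \<Longrightarrow> u \<in> sp (alg2 M) \<Longrightarrow> rho M x y u = - rho M y x u"
    "u \<in> sp (alg2 M) \<Longrightarrow> v \<in> sp (alg2 M) \<Longrightarrow> x \<in> sp (alg1 M) \<Longrightarrow> mu M u v x = - mu M v u x"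
  using assms unfolding pre_matched_def pre_lie3_def pre_rep_def by blast+

lemma double_br_pure:
  assumes vs: "vector_space s" "vector_space t" and M: "pre_matched s t M"
  shows
    "x \<in> sp (alg1 M) \<Longrightarrow> y \<in> sp (alg1 M) \<Longrightarrow> z \<in> sp (alg1 M) \<Longrightarrow>
      br (alg (double M)) (x, 0) (y, 0) (z, 0) = (br (alg1 M) x y z, 0)"
    "u \<in> sp (alg2 M) \<Longrightarrow> v \<in> sp (alg2 M) \<Longrightarrow> w \<in> sp (alg2 M) \<Longrightarrow>
      br (alg (double M)) (0, u) (0, v) (0, w) = (0, br (alg2 M) u v w)"
    "x \<in> sp (alg1 M) \<Longrightarrow> y \<in> sp (alg1 M) \<Longrightarrow> u \<in> sp (alg2 M) \<Longrightarrow>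
      br (alg (double M)) (x, 0) (y, 0) (0, u) = (0, rho M x y u)"
    "u \<in> sp (alg2 M) \<Longrightarrow> v \<in> sp (alg2 M) \<Longrightarrow> x \<in> sp (alg1 M) \<Longrightarrow>
      br (alg (double M)) (0, u) (0, v) (x, 0) = (mu M u v x, 0)"
    "x \<in> sp (alg1 M) \<Longrightarrow> u \<in> sp (alg2 M) \<Longrightarrow> v \<in> sp (alg2 M) \<Longrightarrow>
      br (alg (double M)) (x, 0) (0, u) (0, v) = (mu M u v x, 0)"
proof -
  note z1 = fd_subspace_zero[OF vs(1) pre_matchedD(1)[OF M]]
  note z2 = fd_subspace_zero[OF vs(2) pre_matchedD(2)[OF M]]
  note zeros = trilin_zero[OF pre_matchedD(3)[OF M] z1 z1] trilin_zero[OF pre_matchedD(4)[OF M] z2 z2]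
    trilin_zero[OF pre_matchedD(5)[OF M] z1 z2] trilin_zero[OF pre_matchedD(6)[OF M] z2 z1]
  show
    "x \<in> sp (alg1 M) \<Longrightarrow> y \<in> sp (alg1 M) \<Longrightarrow> z \<in> sp (alg1 M) \<Longrightarrow>
      br (alg (double M)) (x, 0) (y, 0) (z, 0) = (br (alg1 M) x y z, 0)"
    "u \<in> sp (alg2 M) \<Longrightarrow> v \<in> sp (alg2 M) \<Longrightarrow> w \<in> sp (alg2 M) \<Longrightarrow>
      br (alg (double M)) (0, u) (0, v) (0, w) = (0, br (alg2 M) u v w)"
    "x \<in> sp (alg1 M) \<Longrightarrow> y \<in> sp (alg1 M) \<Longrightarrow> u \<in> sp (alg2 M) \<Longrightarrow>
      br (alg (double M)) (x, 0) (y, 0) (0, u) = (0, rho M x y u)"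
    "u \<in> sp (alg2 M) \<Longrightarrow> v \<in> sp (alg2 M) \<Longrightarrow> x \<in> sp (alg1 M) \<Longrightarrow>
      br (alg (double M)) (0, u) (0, v) (x, 0) = (mu M u v x, 0)"
    "x \<in> sp (alg1 M) \<Longrightarrow> u \<in> sp (alg2 M) \<Longrightarrow> v \<in> sp (alg2 M) \<Longrightarrow>
      br (alg (double M)) (x, 0) (0, u) (0, v) = (mu M u v x, 0)"
    by (simp_all add: double_br z1 z2 zeros)
qed

lemma pre_twilled_double:
  assumes vs: "vector_space s" "vector_space t" and M: "pre_matched s t M"
  shows "pre_twilled (module_prod.scale s t) (double M)"
proof -
  let ?A = "sp (alg1 M)" and ?B = "sp (alg2 M)" and ?L = "alg (double M)"
  note fd = pre_matchedD(1,2)[OF M] and tri = pre_matchedD(3-6)[OF M]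
  note clA = fd_subspace_closed[OF vs(1) fd(1)] and clB = fd_subspace_closed[OF vs(2) fd(2)]
  note cl = tri[THEN trilin_closed]
  note scale = prod_scale[OF vs]
  interpret s: vector_space s by (rule vs)
  interpret t: vector_space t by (rule vs)
  note vp = vector_space_prod_scale[OF vs]
  have closed: "br ?L p q r \<in> sp ?L" if "p \<in> sp ?L" "q \<in> sp ?L" "r \<in> sp ?L" for p q r
    using that by (auto simp: double_sel double_br clA clB cl)
  have skew: "br ?L p q r = - br ?L q p r" "br ?L p q r = - br ?L p r q"
    if "p \<in> sp ?L" "q \<in> sp ?L" "r \<in> sp ?L" for p q r
  proof -
    obtain x u y v z w where p: "p = (x, u)" "q = (y, v)" "r = (z, w)"
      by (metis surj_pair)
    have x: "x \<in> ?A" "y \<in> ?A" "z \<in> ?A" and u: "u \<in> ?B" "v \<in> ?B" "w \<in> ?B"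
      using that by (auto simp: double_sel p)
    note sk = pre_matched_skew[OF M]
    show "br ?L p q r = - br ?L q p r"
      using sk(1)[OF x] sk(3)[OF u] sk(5)[OF x(1,2) u(3)] sk(5)[OF x(2,3) u(1)] sk(5)[OF x(3,1) u(2)]
        sk(6)[OF u(1,2) x(3)] sk(6)[OF u(2,3) x(1)] sk(6)[OF u(3,1) x(2)]
      by (simp add: p double_br x u)
    show "br ?L p q r = - br ?L p r q"
      using sk(2)[OF x] sk(4)[OF u] sk(5)[OF x(1,2) u(3)] sk(5)[OF x(2,3) u(1)] sk(5)[OF x(3,1) u(2)]
        sk(6)[OF u(1,2) x(3)] sk(6)[OF u(2,3) x(1)] sk(6)[OF u(3,1) x(2)]
      by (simp add: p double_br x u)
  qed
  have lin: "lin_on (module_prod.scale s t) (module_prod.scale s t) (sp ?L) (\<lambda>r. br ?L p q r)"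
    if "p \<in> sp ?L" "q \<in> sp ?L" for p q
    using that unfolding lin_on_def
    by (auto simp: double_sel double_br scale clA clB s.scale_right_distrib t.scale_right_distrib
        tri[THEN trilin_lin1, THEN lin_on_add] tri[THEN trilin_lin1, THEN lin_on_scale]
        tri[THEN trilin_lin2, THEN lin_on_add] tri[THEN trilin_lin2, THEN lin_on_scale]
        tri[THEN trilin_lin3, THEN lin_on_add] tri[THEN trilin_lin3, THEN lin_on_scale])
  have L: "pre_lie3 (module_prod.scale s t) ?L"
  proof (rule pre_lie3I[OF vp _ _ closed skew lin])
    show "fd_subspace (module_prod.scale s t) (sp ?L)"
      unfolding double_sel by (rule fd_subspace_Times[OF vs fd])
    show "br ?L = (\<lambda>p\<in>sp ?L. \<lambda>q\<in>sp ?L. \<lambda>r\<in>sp ?L. (case (p, q, r) of ((x, u), (y, v), (z, w)) \<Rightarrow>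
                     (br (alg1 M) x y z + mu M u v z + mu M v w x + mu M w u y,
                      br (alg2 M) u v w + rho M x y w + rho M y z u + rho M z x v)))"
      by (simp add: double_def Let_def)
  qed
  note pure = double_br_pure[OF vs M]
  have 1: "module.subspace (module_prod.scale s t) (?A \<times> {0})"
    and 2: "module.subspace (module_prod.scale s t) ({0} \<times> ?B)"
  proof -
    have img: "(\<lambda>x. (x, 0)) ` ?A = ?A \<times> {0}" "(\<lambda>u. (0, u)) ` ?B = {0} \<times> ?B" by auto
    show "module.subspace (module_prod.scale s t) (?A \<times> {0})"
      "module.subspace (module_prod.scale s t) ({0} \<times> ?B)"
      using fd_subspace_image[OF vs(1) vp fd(1) lin_on_Pair(1)[OF vs]]
        fd_subspace_image[OF vs(2) vp fd(2) lin_on_Pair(2)[OF vs]]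
      unfolding img fd_subspace_def by blast+
  qed
  show ?thesis
    unfolding pre_twilled_def lie3_subalgebra_def
  proof (intro conjI ballI L)
    show "sp ?L = {x + u | x u. x \<in> part1 (double M) \<and> u \<in> part2 (double M)}"
      unfolding double_sel by force
  qed (use 1 2 clA(1) clB(1) in \<open>auto simp: double_sel pure cl zero_prod_def\<close>)
qed

lemma split_pair_sel:
  "sp (alg1 (split_pair T)) = part1 T" "sp (alg2 (split_pair T)) = part2 T"
  by (simp_all add: split_pair_def Let_def)

lemma split_pair_ops:
  "x \<in> part1 T \<Longrightarrow> y \<in> part1 T \<Longrightarrow> z \<in> part1 T \<Longrightarrow> br (alg1 (split_pair T)) x y z = br (alg T) x y z"
  "u \<in> part2 T \<Longrightarrow> v \<in> part2 T \<Longrightarrow> w \<in> part2 T \<Longrightarrow> br (alg2 (split_pair T)) u v w = br (alg T) u v w"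
  "x \<in> part1 T \<Longrightarrow> y \<in> part1 T \<Longrightarrow> u \<in> part2 T \<Longrightarrow> rho (split_pair T) x y u = br (alg T) x y u"
  "u \<in> part2 T \<Longrightarrow> v \<in> part2 T \<Longrightarrow> x \<in> part1 T \<Longrightarrow> mu (split_pair T) u v x = br (alg T) u v x"
  by (simp_all add: split_pair_def Let_def)

text \<open>Strictness says that \<open>[A, A, B] \<subseteq> B\<close> and, after rotation, \<open>[B, B, A] \<subseteq> A\<close>: this is why the
  restricted brackets take values in the right summand.\<close>

lemma pre_matched_split_pair:
  assumes vs: "vector_space s" and T: "pre_twilled s T"
  shows "pre_matched s s (split_pair T)"
proof -
  interpret graded_bracket "sp (alg T)" "br (alg T)" "part1 T" "part2 T"
    by (rule pre_twilled_graded_bracket[OF vs T])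
  let ?A = "part1 T" and ?B = "part2 T" and ?b = "br (alg T)"
  have fd: "fd_subspace s (sp (alg T))" and tri: "trilin s s (sp (alg T)) (sp (alg T)) ?b"
    using T by (auto simp: pre_twilled_def pre_lie3_def)
  have sub: "module.subspace s ?A" "module.subspace s ?B"
    and cl: "\<And>x y z. x \<in> ?A \<Longrightarrow> y \<in> ?A \<Longrightarrow> z \<in> ?A \<Longrightarrow> ?b x y z \<in> ?A"
      "\<And>x y z. x \<in> ?B \<Longrightarrow> y \<in> ?B \<Longrightarrow> z \<in> ?B \<Longrightarrow> ?b x y z \<in> ?B"
      "\<And>x y z. x \<in> ?A \<Longrightarrow> y \<in> ?A \<Longrightarrow> z \<in> ?B \<Longrightarrow> ?b x y z \<in> ?B"
      "\<And>x y z. x \<in> ?A \<Longrightarrow> y \<in> ?B \<Longrightarrow> z \<in> ?B \<Longrightarrow> ?b x y z \<in> ?A"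
    using T unfolding pre_twilled_def lie3_subalgebra_def by blast+
  have cl': "?b u v x \<in> ?A" if "x \<in> ?A" "u \<in> ?B" "v \<in> ?B" for x u v
    using cl(4)[OF that] rotate[of x u v] that by (simp add: A_G B_G)
  have fdA: "fd_subspace s ?A" and fdB: "fd_subspace s ?B"
    using fd_subspace_subset[OF vs fd] sub A_G B_G by blast+
  have rep: "pre_rep s s V W (\<lambda>x\<in>V. \<lambda>y\<in>V. \<lambda>w\<in>W. ?b x y w)"
    if V: "fd_subspace s V" "V \<subseteq> sp (alg T)" and W: "fd_subspace s W" "W \<subseteq> sp (alg T)"
      and VW: "\<And>x y w. x \<in> V \<Longrightarrow> y \<in> V \<Longrightarrow> w \<in> W \<Longrightarrow> ?b x y w \<in> W" for V W
  proof -
    note clV = fd_subspace_closed[OF vs V(1)] and clW = fd_subspace_closed[OF vs W(1)]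
    have G: "x \<in> V \<Longrightarrow> x \<in> sp (alg T)" "x \<in> W \<Longrightarrow> x \<in> sp (alg T)" for x using V W by blast+
    have "trilin s s V W (\<lambda>x\<in>V. \<lambda>y\<in>V. \<lambda>w\<in>W. ?b x y w)"
    proof -
      have "(\<lambda>x\<in>V. \<lambda>y\<in>V. \<lambda>w\<in>W. ?b x y w) \<in> V \<rightarrow>\<^sub>E V \<rightarrow>\<^sub>E W \<rightarrow>\<^sub>E W"
        using VW by auto
      moreover have "?b (s c x) y w = s c (?b x y w)" "?b x (s c y) w = s c (?b x y w)"
        "?b x y (s c w) = s c (?b x y w)" if "x \<in> V" "y \<in> V" "w \<in> W" for c x y w
        by (simp_all add: that G lin_on_scale[OF trilin_lin1[OF tri]]
          lin_on_scale[OF trilin_lin2[OF tri]] lin_on_scale[OF trilin_lin3[OF tri]])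
      ultimately show ?thesis
        by (simp add: trilin_def lin_on_def clV clW add1 add2 add3 G)
    qed
    moreover have "(\<lambda>x\<in>V. \<lambda>y\<in>V. \<lambda>w\<in>W. ?b x y w) x y w = - (\<lambda>x\<in>V. \<lambda>y\<in>V. \<lambda>w\<in>W. ?b x y w) y x w"
      if "x \<in> V" "y \<in> V" "w \<in> W" for x y w
      using skew12[of x y w] that by (simp add: G)
    ultimately show ?thesis
      unfolding pre_rep_def by blast
  qed
  have A_sub: "?A \<subseteq> sp (alg T)" and B_sub: "?B \<subseteq> sp (alg T)" using A_G B_G by blast+
  have "br (alg1 (split_pair T)) x y z = - br (alg1 (split_pair T)) x z y"
    if "x \<in> ?A" "y \<in> ?A" "z \<in> ?A" for x y z
    using skew23[of x y z] that by (simp add: split_pair_ops A_G)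
  moreover have "br (alg2 (split_pair T)) x y z = - br (alg2 (split_pair T)) x z y"
    if "x \<in> ?B" "y \<in> ?B" "z \<in> ?B" for x y z
    using skew23[of x y z] that by (simp add: split_pair_ops B_G)
  moreover have ops: "br (alg1 (split_pair T)) = (\<lambda>x\<in>?A. \<lambda>y\<in>?A. \<lambda>z\<in>?A. ?b x y z)"
    "br (alg2 (split_pair T)) = (\<lambda>u\<in>?B. \<lambda>v\<in>?B. \<lambda>w\<in>?B. ?b u v w)"
    "rho (split_pair T) = (\<lambda>x\<in>?A. \<lambda>y\<in>?A. \<lambda>u\<in>?B. ?b x y u)"
    "mu (split_pair T) = (\<lambda>u\<in>?B. \<lambda>v\<in>?B. \<lambda>x\<in>?A. ?b u v x)"
    by (simp_all add: split_pair_def Let_def)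
  moreover note rep[OF fdA A_sub fdA A_sub cl(1), folded ops] rep[OF fdB B_sub fdB B_sub cl(2), folded ops]
    rep[OF fdA A_sub fdB B_sub cl(3), folded ops] rep[OF fdB B_sub fdA A_sub cl', folded ops]
  ultimately show ?thesis
    using fdA fdB unfolding pre_matched_def pre_lie3_def pre_rep_def split_pair_sel by blast
qed

text \<open>The double contains a copy of the original pair: its bracket on the homogeneous elements
  \<open>(x, 0)\<close> and \<open>(0, u)\<close> has at most one nonzero term.\<close>

lemma matched_pair_iso_split_double:
  assumes vs: "vector_space s" "vector_space t" and M: "pre_matched s t M"
  shows "matched_pair_iso s t (module_prod.scale s t) (module_prod.scale s t)
    (\<lambda>x. (x, 0)) (\<lambda>u. (0, u)) M (split_pair (double M))"
  unfolding matched_pair_iso_def Let_def split_pair_sel double_sel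
  by (auto simp: lin_on_Pair vs split_pair_ops double_sel double_br_pure[OF vs M]
      bij_betw_def inj_on_def)

text \<open>The multilinear expansion of the bracket of \<open>T\<close> is term by term the defining formula of the double;
  in particular, the pair cut out of \<open>T\<close> determines \<open>T\<close>.\<close>

lemma double_split_br:
  assumes vs: "vector_space s" and T: "pre_twilled s T"
    and x: "x \<in> part1 T" "y \<in> part1 T" "z \<in> part1 T"
    and u: "u \<in> part2 T" "v \<in> part2 T" "w \<in> part2 T"
  shows "br (alg T) (x + u) (y + v) (z + w) =
    (case br (alg (double (split_pair T))) (x, u) (y, v) (z, w) of (a, c) \<Rightarrow> a + c)"
proof -
  interpret graded_bracket "sp (alg T)" "br (alg T)" "part1 T" "part2 T"
    by (rule pre_twilled_graded_bracket[OF vs T])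
  show ?thesis
    using x u by (simp add: bracket_sum double_br split_pair_sel split_pair_ops)
qed

lemma direct_sum_inj:
  assumes vs: "vector_space s" and A: "fd_subspace s A" and B: "fd_subspace s B" and AB: "A \<inter> B = {0}"
  shows "inj_on (\<lambda>(x, u). x + u) (A \<times> B)"
proof -
  have "x = y \<and> u = v" if "x \<in> A" "y \<in> A" "u \<in> B" "v \<in> B" and eq: "x + u = y + v" for x y u v
  proof -
    have "x - y = v - u" using eq by (simp add: algebra_simps)
    moreover have "x - y \<in> A" "v - u \<in> B"
      using fd_subspace_add[OF vs A] fd_subspace_neg[OF vs A]
        fd_subspace_add[OF vs B] fd_subspace_neg[OF vs B] that
      by (metis add_uminus_conv_diff)+
    ultimately have "x - y = 0" "v - u = 0" using AB by (metis IntI empty_iff insert_iff)+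
    then show ?thesis by simp
  qed
  then show ?thesis by (auto simp: inj_on_def)
qed

lemma lin_on_sum:
  assumes vs: "vector_space s"
  shows "lin_on (module_prod.scale s s) s V (\<lambda>(x, u). x + u)"
proof -
  interpret vector_space s by (rule vs)
  show ?thesis
    by (auto simp: lin_on_def prod_scale[OF vs vs] scale_right_distrib algebra_simps)
qed

lemma twilled_iso_double_split:
  assumes vs: "vector_space s" and T: "pre_twilled s T"
  shows "twilled_iso (module_prod.scale s s) s (\<lambda>(x, u). x + u) (double (split_pair T)) T"
proof -
  let ?A = "part1 T" and ?B = "part2 T"
  have G: "sp (alg T) = {x + u | x u. x \<in> ?A \<and> u \<in> ?B}" and AB: "?A \<inter> ?B = {0}"
    using T by (auto simp: pre_twilled_def)
  note fd = pre_matchedD(1,2)[OF pre_matched_split_pair[OF vs T], unfolded split_pair_sel]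
  have "bij_betw (\<lambda>(x, u). x + u) (?A \<times> ?B) (sp (alg T))"
    using direct_sum_inj[OF vs fd AB] by (auto simp: bij_betw_def G)
  moreover have "(\<lambda>(x, u). x + u) ` (?A \<times> {0}) = ?A" "(\<lambda>(x, u). x + u) ` ({0} \<times> ?B) = ?B"
    by force+
  ultimately show ?thesis
    by (auto simp: twilled_iso_def Let_def double_sel split_pair_sel lin_on_sum[OF vs]
        double_split_br[OF vs T])
qed

section \<open>Bijectivity of the two constructions\<close>

lemma matched_pair_pre: "matched_pair s t M \<Longrightarrow> pre_matched s t M"
  by (simp add: matched_pair_iff_halves)

lemma strict_twilled_pre: "vector_space s \<Longrightarrow> strict_twilled s T \<Longrightarrow> pre_twilled s T"
  by (simp add: strict_twilled_iff_fund_id)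

lemma lie3_pair_eqI:
  fixes M M' :: "('a, 'b) lie3_pair"
  assumes "sp (alg1 M) = sp (alg1 M')" "br (alg1 M) = br (alg1 M')"
    "sp (alg2 M) = sp (alg2 M')" "br (alg2 M) = br (alg2 M')" "rho M = rho M'" "mu M = mu M'"
  shows "M = M'"
  using assms by (auto intro!: lie3_pair.equality lie3.equality)

lemma twilled_eqI:
  fixes T T' :: "'a twilled"
  assumes "sp (alg T) = sp (alg T')" "br (alg T) = br (alg T')" "part1 T = part1 T'" "part2 T = part2 T'"
  shows "T = T'"
  using assms by (auto intro!: twilled.equality lie3.equality)

lemma pre_matched_eqI:
  assumes M: "pre_matched s t M" and M': "pre_matched s t M'"
    and sp: "sp (alg1 M) = sp (alg1 M')" "sp (alg2 M) = sp (alg2 M')"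
    and "\<And>x y z. x \<in> sp (alg1 M) \<Longrightarrow> y \<in> sp (alg1 M) \<Longrightarrow> z \<in> sp (alg1 M) \<Longrightarrow>
      br (alg1 M) x y z = br (alg1 M') x y z"
    and "\<And>u v w. u \<in> sp (alg2 M) \<Longrightarrow> v \<in> sp (alg2 M) \<Longrightarrow> w \<in> sp (alg2 M) \<Longrightarrow>
      br (alg2 M) u v w = br (alg2 M') u v w"
    and "\<And>x y u. x \<in> sp (alg1 M) \<Longrightarrow> y \<in> sp (alg1 M) \<Longrightarrow> u \<in> sp (alg2 M) \<Longrightarrow>
      rho M x y u = rho M' x y u"
    and "\<And>u v x. u \<in> sp (alg2 M) \<Longrightarrow> v \<in> sp (alg2 M) \<Longrightarrow> x \<in> sp (alg1 M) \<Longrightarrow>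
      mu M u v x = mu M' u v x"
  shows "M = M'"
proof (rule lie3_pair_eqI)
  note D = pre_matchedD[OF M] and D' = pre_matchedD[OF M', folded sp]
  show "br (alg1 M) = br (alg1 M')" by (rule trilin_eqI[OF D(3) D'(3)]) fact
  show "br (alg2 M) = br (alg2 M')" by (rule trilin_eqI[OF D(4) D'(4)]) fact
  show "rho M = rho M'" by (rule trilin_eqI[OF D(5) D'(5)]) fact
  show "mu M = mu M'" by (rule trilin_eqI[OF D(6) D'(6)]) fact
qed (fact sp)+

lemma pre_twilled_eqI:
  assumes T: "pre_twilled s T" and T': "pre_twilled s T'"
    and part: "part1 T = part1 T'" "part2 T = part2 T'"
    and br: "\<And>x y z u v w. x \<in> part1 T \<Longrightarrow> y \<in> part1 T \<Longrightarrow> z \<in> part1 T \<Longrightarrow>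
      u \<in> part2 T \<Longrightarrow> v \<in> part2 T \<Longrightarrow> w \<in> part2 T \<Longrightarrow>
      br (alg T) (x + u) (y + v) (z + w) = br (alg T') (x + u) (y + v) (z + w)"
  shows "T = T'"
proof (rule twilled_eqI)
  have G: "sp (alg T) = {x + u | x u. x \<in> part1 T \<and> u \<in> part2 T}"
    using T by (simp only: pre_twilled_def)
  show sp: "sp (alg T) = sp (alg T')"
    using T' unfolding G pre_twilled_def part by blast
  have tri: "trilin s s (sp (alg T)) (sp (alg T)) (br (alg T))"
    "trilin s s (sp (alg T)) (sp (alg T)) (br (alg T'))"
    using T T' unfolding pre_twilled_def pre_lie3_def sp by blast+
  show "br (alg T) = br (alg T')"
  proof (rule trilin_eqI[OF tri])
    fix p q r assume "p \<in> sp (alg T)" "q \<in> sp (alg T)" "r \<in> sp (alg T)"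
    then show "br (alg T) p q r = br (alg T') p q r"
      unfolding G by (auto simp: br)
  qed
qed (fact part)+

lemma double_inj:
  fixes M M' :: "('a::ab_group_add, 'b::ab_group_add) lie3_pair"
  assumes vs: "vector_space s" "vector_space t"
    and M: "pre_matched s t M" and M': "pre_matched s t M'" and eq: "double M = double M'"
  shows "M = M'"
proof -
  have "sp (alg1 M) \<times> {0} = sp (alg1 M') \<times> {0::'b}" "{0::'a} \<times> sp (alg2 M) = {0} \<times> sp (alg2 M')"
    using arg_cong[OF eq, of part1] arg_cong[OF eq, of part2] by (simp_all only: double_sel)
  then have sp: "sp (alg1 M) = sp (alg1 M')" "sp (alg2 M) = sp (alg2 M')" by auto
  note pure = double_br_pure[OF vs M] and pure' = double_br_pure[OF vs M', folded sp eq]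
  show ?thesis
  proof (rule pre_matched_eqI[OF M M' sp])
    fix x y z assume *: "x \<in> sp (alg1 M)" "y \<in> sp (alg1 M)" "z \<in> sp (alg1 M)"
    show "br (alg1 M) x y z = br (alg1 M') x y z" using pure(1)[OF *] pure'(1)[OF *] by simp
  next
    fix u v w assume *: "u \<in> sp (alg2 M)" "v \<in> sp (alg2 M)" "w \<in> sp (alg2 M)"
    show "br (alg2 M) u v w = br (alg2 M') u v w" using pure(2)[OF *] pure'(2)[OF *] by simp
  next
    fix x y u assume *: "x \<in> sp (alg1 M)" "y \<in> sp (alg1 M)" "u \<in> sp (alg2 M)"
    show "rho M x y u = rho M' x y u" using pure(3)[OF *] pure'(3)[OF *] by simp
  next
    fix u v x assume *: "u \<in> sp (alg2 M)" "v \<in> sp (alg2 M)" "x \<in> sp (alg1 M)"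
    show "mu M u v x = mu M' u v x" using pure(4)[OF *] pure'(4)[OF *] by simp
  qed
qed

lemma split_pair_inj:
  assumes vs: "vector_space s" and T: "pre_twilled s T" and T': "pre_twilled s T'"
    and eq: "split_pair T = split_pair T'"
  shows "T = T'"
proof -
  have part: "part1 T = part1 T'" "part2 T = part2 T'"
    using arg_cong[OF eq, of "\<lambda>M. sp (alg1 M)"] arg_cong[OF eq, of "\<lambda>M. sp (alg2 M)"]
    by (simp_all only: split_pair_sel)
  show ?thesis
    by (rule pre_twilled_eqI[OF T T' part])
      (simp add: double_split_br[OF vs T] double_split_br[OF vs T', folded part] eq)
qed

lemma strict_twilled_double:
  assumes vs: "vector_space s" "vector_space t" and M: "matched_pair s t M"
  shows "strict_twilled (module_prod.scale s t) (double M)"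
proof -
  note pre = matched_pair_pre[OF M]
  show ?thesis
    using matched_pair_iff_strict_twilled[OF vs vector_space_prod_scale[OF vs] pre
        pre_twilled_double[OF vs pre] matched_pair_iso_split_double[OF vs pre]] M by blast
qed

text \<open>Brackets and actions are read off by projecting the brackets of homogeneous elements. As \<open>M\<close> is the
  image of the pair cut out of \<open>T\<close> under the projections, it inherits trilinearity and
  skew-symmetry, and the multilinear expansion shows that doubling it gives \<open>T\<close> back.\<close>

lemma double_surj:
  assumes vs: "vector_space s" "vector_space t"
    and T: "strict_twilled (module_prod.scale s t) T"
    and part: "part1 T = A \<times> {0}" "part2 T = {0} \<times> B"
  shows "\<exists>M. matched_pair s t M \<and> double M = T"
proof -
  let ?b = "br (alg T)" and ?r = "module_prod.scale s t" and ?P = "split_pair T"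
  note vp = vector_space_prod_scale[OF vs]
  note preT = strict_twilled_pre[OF vp T]
  note P = pre_matched_split_pair[OF vp preT]
  interpret graded_bracket "sp (alg T)" ?b "part1 T" "part2 T"
    by (rule pre_twilled_graded_bracket[OF vp preT])
  define M where "M =
    \<lparr> alg1 = \<lparr> sp = A, br = (\<lambda>x\<in>A. \<lambda>y\<in>A. \<lambda>z\<in>A. fst (?b (x, 0) (y, 0) (z, 0))) \<rparr>,
      alg2 = \<lparr> sp = B, br = (\<lambda>u\<in>B. \<lambda>v\<in>B. \<lambda>w\<in>B. snd (?b (0, u) (0, v) (0, w))) \<rparr>,
      rho = (\<lambda>x\<in>A. \<lambda>y\<in>A. \<lambda>u\<in>B. snd (?b (x, 0) (y, 0) (0, u))),
      mu = (\<lambda>u\<in>B. \<lambda>v\<in>B. \<lambda>x\<in>A. fst (?b (0, u) (0, v) (x, 0))) \<rparr>"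
  note fd = pre_matchedD(1,2)[OF P, unfolded split_pair_sel]
  have img: "fst ` part1 T = A" "snd ` part2 T = B" unfolding part by force+
  have M: "pre_matched s t M"
  proof -
    note lin = lin_on_fst_snd[OF vs]
    have "pre_lie3 s (alg1 M)" if "pre_lie3 ?r (alg1 ?P)"
      by (rule pre_lie3_image[OF vp vs(1) that lin(1)])
        (auto simp: M_def split_pair_sel split_pair_ops img part intro!: restrict_ext)
    moreover have "pre_lie3 t (alg2 M)" if "pre_lie3 ?r (alg2 ?P)"
      by (rule pre_lie3_image[OF vp vs(2) that lin(2)])
        (auto simp: M_def split_pair_sel split_pair_ops img part intro!: restrict_ext)
    moreover have "pre_rep s t A B (rho M)" if "pre_rep ?r ?r (part1 T) (part2 T) (rho ?P)"
      by (rule pre_rep_image[OF vp vp fd that lin, unfolded img])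
        (auto simp: M_def split_pair_ops part intro!: restrict_ext)
    moreover have "pre_rep t s B A (mu M)" if "pre_rep ?r ?r (part2 T) (part1 T) (mu ?P)"
      by (rule pre_rep_image[OF vp vp fd(2,1) that lin(2,1), unfolded img])
        (auto simp: M_def split_pair_ops part intro!: restrict_ext)
    ultimately show ?thesis using P by (simp add: pre_matched_def split_pair_sel) (simp add: M_def)
  qed
  \<comment> \<open>Homogeneous brackets lie in one of the summands, so the projections lose nothing.\<close>
  note Pcl = pre_matchedD(3-6)[OF P, THEN trilin_closed, unfolded split_pair_sel]
  have b: "x \<in> A \<Longrightarrow> y \<in> A \<Longrightarrow> z \<in> A \<Longrightarrow> ?b (x, 0) (y, 0) (z, 0) = (br (alg1 M) x y z, 0)"
      "u \<in> B \<Longrightarrow> v \<in> B \<Longrightarrow> w \<in> B \<Longrightarrow> ?b (0, u) (0, v) (0, w) = (0, br (alg2 M) u v w)"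
      "x \<in> A \<Longrightarrow> y \<in> A \<Longrightarrow> u \<in> B \<Longrightarrow> ?b (x, 0) (y, 0) (0, u) = (0, rho M x y u)"
      "u \<in> B \<Longrightarrow> v \<in> B \<Longrightarrow> x \<in> A \<Longrightarrow> ?b (0, u) (0, v) (x, 0) = (mu M u v x, 0)"
    for x y z u v w
    using Pcl(1)[of "(x, 0)" "(y, 0)" "(z, 0)"] Pcl(2)[of "(0, u)" "(0, v)" "(0, w)"]
      Pcl(3)[of "(x, 0)" "(y, 0)" "(0, u)"] Pcl(4)[of "(0, u)" "(0, v)" "(x, 0)"]
    by (auto simp: M_def part split_pair_ops)
  have selM: "sp (alg1 M) = A" "sp (alg2 M) = B" by (simp_all add: M_def)
  have "double M = T"
  proof (rule pre_twilled_eqI[OF pre_twilled_double[OF vs M] preT])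
    show parts: "part1 (double M) = part1 T" "part2 (double M) = part2 T"
      by (simp_all add: double_sel selM part)
    fix p q r p' q' r'
    assume "p \<in> part1 (double M)" "q \<in> part1 (double M)" "r \<in> part1 (double M)"
      "p' \<in> part2 (double M)" "q' \<in> part2 (double M)" "r' \<in> part2 (double M)"
    then obtain x y z u v w where *: "x \<in> A" "y \<in> A" "z \<in> A" "u \<in> B" "v \<in> B" "w \<in> B"
      and eq: "p = (x, 0)" "q = (y, 0)" "r = (z, 0)" "p' = (0, u)" "q' = (0, v)" "r' = (0, w)"
      unfolding parts part by blast
    have "?b (p + p') (q + q') (r + r') =
      (?b p q r + ?b p' q' r + ?b q' r' p + ?b r' p' q) + (?b p' q' r' + ?b p q r' + ?b q r p' + ?b r p q')"
      by (rule bracket_sum) (use * in \<open>simp_all add: part eq\<close>)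
    also have "\<dots> = br (alg (double M)) (p + p') (q + q') (r + r')"
      using * by (simp add: eq b double_br selM)
    finally show "br (alg (double M)) (p + p') (q + q') (r + r') = ?b (p + p') (q + q') (r + r')" ..
  qed
  moreover have "matched_pair s t M"
    using matched_pair_iff_strict_twilled[OF vs vp M pre_twilled_double[OF vs M]
        matched_pair_iso_split_double[OF vs M]] T \<open>double M = T\<close> by blast
  ultimately show ?thesis by blast
qed

lemma matched_pair_iso_id: "matched_pair_iso s t s t (\<lambda>x. x) (\<lambda>u. u) M M"
  by (simp add: matched_pair_iso_def lin_on_def Let_def bij_betw_def)

lemma matched_pair_split_pair:
  assumes vs: "vector_space s" and T: "strict_twilled s T"
  shows "matched_pair s s (split_pair T)" "sp (alg1 (split_pair T)) \<inter> sp (alg2 (split_pair T)) = {0}"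
proof -
  note pre = strict_twilled_pre[OF vs T]
  show "matched_pair s s (split_pair T)"
    using matched_pair_iff_strict_twilled[OF vs vs vs pre_matched_split_pair[OF vs pre] pre
        matched_pair_iso_id] T by blast
  show "sp (alg1 (split_pair T)) \<inter> sp (alg2 (split_pair T)) = {0}"
    using pre by (simp add: split_pair_sel pre_twilled_def)
qed

lemma pre_twilled_image:
  assumes vs: "vector_space s" "vector_space t" and T: "pre_twilled s T"
    and h: "lin_on s t (sp (alg T)) h" "inj_on h (sp (alg T))"
    and sp: "sp (alg T') = h ` sp (alg T)" "part1 T' = h ` part1 T" "part2 T' = h ` part2 T"
    and g: "br (alg T') = (\<lambda>x\<in>sp (alg T'). \<lambda>y\<in>sp (alg T'). \<lambda>z\<in>sp (alg T'). g x y z)"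
    and hom: "\<And>x y z. x \<in> sp (alg T) \<Longrightarrow> y \<in> sp (alg T) \<Longrightarrow> z \<in> sp (alg T) \<Longrightarrow>
      br (alg T') (h x) (h y) (h z) = h (br (alg T) x y z)"
  shows "pre_twilled t T'"
proof -
  interpret graded_bracket "sp (alg T)" "br (alg T)" "part1 T" "part2 T"
    by (rule pre_twilled_graded_bracket[OF vs(1) T])
  note fd = pre_matchedD(1,2)[OF pre_matched_split_pair[OF vs(1) T], unfolded split_pair_sel]
  have h0: "h 0 = 0" by (rule lin_on_zero[OF h(1) zero])
  have sub: "lin_on s t (part1 T) h" "lin_on s t (part2 T) h"
    using h(1) A_G B_G by (auto simp: lin_on_def)
  have 1: "pre_lie3 t (alg T')"
    by (rule pre_lie3_image[OF vs _ h(1) sp(1) g hom]) (use T in \<open>simp_all only: pre_twilled_def\<close>)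
  have 2: "module.subspace t (part1 T')" "module.subspace t (part2 T')"
    using fd_subspace_image[OF vs fd(1) sub(1)] fd_subspace_image[OF vs fd(2) sub(2)]
    by (simp_all add: sp fd_subspace_def)
  have 3: "part1 T' \<inter> part2 T' = {0}"
  proof -
    have "part1 T' \<inter> part2 T' = h ` (part1 T \<inter> part2 T)"
      unfolding sp by (rule inj_on_image_Int[OF h(2), symmetric]) (use A_G B_G in blast)+
    also have "part1 T \<inter> part2 T = {0}" using T by (simp only: pre_twilled_def)
    finally show ?thesis by (simp add: h0)
  qed
  have 4: "sp (alg T') = {x + u | x u. x \<in> part1 T' \<and> u \<in> part2 T'}"
  proof -
    have "sp (alg T') = {h (x + u) | x u. x \<in> part1 T \<and> u \<in> part2 T}"
      unfolding sp by (subst G_sum) blast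
    also have "\<dots> = {h x + h u | x u. x \<in> part1 T \<and> u \<in> part2 T}"
      using lin_on_add[OF h(1) A_G B_G] by metis
    also have "\<dots> = {x + u | x u. x \<in> part1 T' \<and> u \<in> part2 T'}"
      unfolding sp by blast
    finally show ?thesis .
  qed
  have 5: "part1 T' \<subseteq> sp (alg T')" "part2 T' \<subseteq> sp (alg T')" unfolding sp using A_G B_G by blast+
  have 6: "\<forall>x\<in>h ` X. \<forall>y\<in>h ` Y. \<forall>z\<in>h ` Z. br (alg T') x y z \<in> h ` W"
    if "\<forall>x\<in>X. \<forall>y\<in>Y. \<forall>z\<in>Z. br (alg T) x y z \<in> W" "X \<subseteq> sp (alg T)" "Y \<subseteq> sp (alg T)" "Z \<subseteq> sp (alg T)"
    for X Y Z W
    using that by (auto simp: hom subset_iff)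
  have A: "part1 T \<subseteq> sp (alg T)" and B: "part2 T \<subseteq> sp (alg T)" using A_G B_G by blast+
  have "\<forall>x\<in>part1 T. \<forall>y\<in>part1 T. \<forall>z\<in>part1 T. br (alg T) x y z \<in> part1 T"
    "\<forall>x\<in>part2 T. \<forall>y\<in>part2 T. \<forall>z\<in>part2 T. br (alg T) x y z \<in> part2 T"
    "\<forall>x\<in>part1 T. \<forall>y\<in>part1 T. \<forall>z\<in>part2 T. br (alg T) x y z \<in> part2 T"
    "\<forall>x\<in>part1 T. \<forall>y\<in>part2 T. \<forall>z\<in>part2 T. br (alg T) x y z \<in> part1 T"
    using T unfolding pre_twilled_def lie3_subalgebra_def by blast+
  note 7 = 6[OF this(1) A A A, folded sp] 6[OF this(2) B B B, folded sp]
    6[OF this(3) A A B, folded sp] 6[OF this(4) A B B, folded sp]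
  show ?thesis
    unfolding pre_twilled_def lie3_subalgebra_def by (intro conjI 1 2 3 4 5 7)
qed

text \<open>The internal algebra is the double transported along \<open>(x, u) \<mapsto> x + u\<close>, which is injective because
  the two spaces meet only in \<open>0\<close>.\<close>

lemma split_pair_surj:
  assumes vs: "vector_space s" and M: "matched_pair s s M" and AB: "sp (alg1 M) \<inter> sp (alg2 M) = {0}"
  shows "\<exists>T. strict_twilled s T \<and> split_pair T = M"
proof -
  let ?A = "sp (alg1 M)" and ?B = "sp (alg2 M)" and ?h = "\<lambda>(x, u). x + u"
  note pre = matched_pair_pre[OF M]
  note fd = pre_matchedD(1,2)[OF pre]
  note zero = fd_subspace_zero[OF vs fd(1)] fd_subspace_zero[OF vs fd(2)]
  define G where "G = ?h ` (?A \<times> ?B)"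
  define k where "k = inv_into (?A \<times> ?B) ?h"
  define g where "g p q r = ?h (br (alg (double M)) (k p) (k q) (k r))" for p q r
  define T where "T = \<lparr> alg = \<lparr> sp = G, br = (\<lambda>p\<in>G. \<lambda>q\<in>G. \<lambda>r\<in>G. g p q r) \<rparr>,
    part1 = ?A, part2 = ?B \<rparr>"
  have inj: "inj_on ?h (?A \<times> ?B)" by (rule direct_sum_inj[OF vs fd AB])
  have hom: "br (alg T) (?h p) (?h q) (?h r) = ?h (br (alg (double M)) p q r)"
    if "p \<in> ?A \<times> ?B" "q \<in> ?A \<times> ?B" "r \<in> ?A \<times> ?B" for p q r
    using that imageI[of _ _ ?h]
    by (simp add: T_def G_def g_def k_def inv_into_f_f[OF inj] del: split_paired_All)
  have T: "pre_twilled s T"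
  proof (rule pre_twilled_image[OF vector_space_prod_scale[OF vs vs] vs
        pre_twilled_double[OF vs vs pre] lin_on_sum[OF vs]])
    show "inj_on ?h (sp (alg (double M)))" unfolding double_sel by (rule inj)
    show "sp (alg T) = ?h ` sp (alg (double M))" by (simp add: T_def G_def double_sel)
    show "part1 T = ?h ` part1 (double M)" by (force simp: T_def double_sel)
    show "part2 T = ?h ` part2 (double M)" by (force simp: T_def double_sel)
    show "br (alg T) = (\<lambda>p\<in>sp (alg T). \<lambda>q\<in>sp (alg T). \<lambda>r\<in>sp (alg T). g p q r)"
      by (simp add: T_def)
  qed (use hom in \<open>simp only: double_sel\<close>)
  have sp: "sp (alg1 (split_pair T)) = ?A" "sp (alg2 (split_pair T)) = ?B" "part1 T = ?A" "part2 T = ?B"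
    by (simp_all add: split_pair_sel T_def)
  note pure = double_br_pure[OF vs vs pre]
  have "split_pair T = M"
  proof (rule pre_matched_eqI[OF pre_matched_split_pair[OF vs T] pre sp(1,2)]; unfold sp(1,2))
    fix x y z assume *: "x \<in> ?A" "y \<in> ?A" "z \<in> ?A"
    show "br (alg1 (split_pair T)) x y z = br (alg1 M) x y z"
      using hom[of "(x, 0)" "(y, 0)" "(z, 0)"] * zero pure(1)[OF *] by (simp add: split_pair_ops sp)
  next
    fix u v w assume *: "u \<in> ?B" "v \<in> ?B" "w \<in> ?B"
    show "br (alg2 (split_pair T)) u v w = br (alg2 M) u v w"
      using hom[of "(0, u)" "(0, v)" "(0, w)"] * zero pure(2)[OF *] by (simp add: split_pair_ops sp)
  next
    fix x y u assume *: "x \<in> ?A" "y \<in> ?A" "u \<in> ?B"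
    show "rho (split_pair T) x y u = rho M x y u"
      using hom[of "(x, 0)" "(y, 0)" "(0, u)"] * zero pure(3)[OF *] by (simp add: split_pair_ops sp)
  next
    fix u v x assume *: "u \<in> ?B" "v \<in> ?B" "x \<in> ?A"
    show "mu (split_pair T) u v x = mu M u v x"
      using hom[of "(0, u)" "(0, v)" "(x, 0)"] * zero pure(4)[OF *] by (simp add: split_pair_ops sp)
  qed
  moreover have "strict_twilled s T"
    using matched_pair_iff_strict_twilled[OF vs vs vs pre_matched_split_pair[OF vs T] T
        matched_pair_iso_id] M \<open>split_pair T = M\<close> by simp
  ultimately show ?thesis by blast
qed

section \<open>Isomorphisms of doubles\<close>

lemma matched_pair_isoD:
  assumes "matched_pair_iso s t s' t' f g M M'"
  shows "lin_on s s' (sp (alg1 M)) f" "bij_betw f (sp (alg1 M)) (sp (alg1 M'))"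
    "lin_on t t' (sp (alg2 M)) g" "bij_betw g (sp (alg2 M)) (sp (alg2 M'))"
    "x \<in> sp (alg1 M) \<Longrightarrow> y \<in> sp (alg1 M) \<Longrightarrow> z \<in> sp (alg1 M) \<Longrightarrow>
      f (br (alg1 M) x y z) = br (alg1 M') (f x) (f y) (f z)"
    "u \<in> sp (alg2 M) \<Longrightarrow> v \<in> sp (alg2 M) \<Longrightarrow> w \<in> sp (alg2 M) \<Longrightarrow>
      g (br (alg2 M) u v w) = br (alg2 M') (g u) (g v) (g w)"
    "x \<in> sp (alg1 M) \<Longrightarrow> y \<in> sp (alg1 M) \<Longrightarrow> u \<in> sp (alg2 M) \<Longrightarrow>
      g (rho M x y u) = rho M' (f x) (f y) (g u)"
    "u \<in> sp (alg2 M) \<Longrightarrow> v \<in> sp (alg2 M) \<Longrightarrow> x \<in> sp (alg1 M) \<Longrightarrow>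
      f (mu M u v x) = mu M' (g u) (g v) (f x)"
  using assms by (simp_all add: matched_pair_iso_def Let_def)

text \<open>The formula for the bracket of the double is natural in the pair.\<close>

lemma twilled_iso_of_matched_pair_iso:
  assumes vs: "vector_space s" "vector_space t" "vector_space s'" "vector_space t'"
    and M: "pre_matched s t M"
    and iso: "matched_pair_iso s t s' t' f g M M'"
  shows "twilled_iso (module_prod.scale s t) (module_prod.scale s' t') (map_prod f g)
    (double M) (double M')"
proof -
  let ?A = "sp (alg1 M)" and ?B = "sp (alg2 M)"
  note D = matched_pair_isoD[OF iso]
  note clA = fd_subspace_closed[OF vs(1) pre_matchedD(1)[OF M]]
    and clB = fd_subspace_closed[OF vs(2) pre_matchedD(2)[OF M]]
  note cl = pre_matchedD(3-6)[OF M, THEN trilin_closed]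
  have in1: "f x \<in> sp (alg1 M')" if "x \<in> ?A" for x using D(2) that by (auto simp: bij_betw_def)
  have in2: "g x \<in> sp (alg2 M')" if "x \<in> ?B" for x using D(4) that by (auto simp: bij_betw_def)
  have f0: "f 0 = 0" and g0: "g 0 = 0"
    using lin_on_zero[OF D(1) clA(1)] lin_on_zero[OF D(3) clB(1)] by auto
  have "lin_on (module_prod.scale s t) (module_prod.scale s' t') (?A \<times> ?B) (map_prod f g)"
    by (auto simp: lin_on_def prod_scale vs lin_on_add[OF D(1)] lin_on_add[OF D(3)]
        lin_on_scale[OF D(1)] lin_on_scale[OF D(3)])
  moreover have "bij_betw (map_prod f g) (?A \<times> ?B) (sp (alg1 M') \<times> sp (alg2 M'))"
    using D(2,4) by (rule bij_betw_map_prod)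
  moreover have "map_prod f g ` (?A \<times> {0}) = sp (alg1 M') \<times> {0}"
    "map_prod f g ` ({0} \<times> ?B) = {0} \<times> sp (alg2 M')"
    using D(2,4) by (simp_all add: map_prod_surj_on bij_betw_def f0 g0)
  moreover have "map_prod f g (br (alg (double M)) p q r) =
      br (alg (double M')) (map_prod f g p) (map_prod f g q) (map_prod f g r)"
    if "p \<in> ?A \<times> ?B" "q \<in> ?A \<times> ?B" "r \<in> ?A \<times> ?B" for p q r
    using that by (auto simp: double_br in1 in2 D(5-8) lin_on_add[OF D(1)] lin_on_add[OF D(3)]
        clA clB cl)
  ultimately show ?thesis
    unfolding twilled_iso_def Let_def double_sel by blast
qed

text \<open>An isomorphism of twilled algebras preserves both summands, so it is block diagonal; its two blocks
  intertwine the brackets of homogeneous elements, that is, the brackets and actions of the pairs.\<close>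

lemma matched_pair_iso_of_twilled_iso:
  assumes vs: "vector_space s" "vector_space t" "vector_space s'" "vector_space t'"
    and M: "pre_matched s t M" and M': "pre_matched s' t' M'"
    and iso: "twilled_iso (module_prod.scale s t) (module_prod.scale s' t') h (double M) (double M')"
  shows "matched_pair_iso s t s' t' (\<lambda>x. fst (h (x, 0))) (\<lambda>u. snd (h (0, u))) M M'"
proof -
  let ?A = "sp (alg1 M)" and ?B = "sp (alg2 M)" and ?A' = "sp (alg1 M')" and ?B' = "sp (alg2 M')"
  define f where "f x = fst (h (x, 0))" for x
  define g where "g u = snd (h (0, u))" for u
  note clA = fd_subspace_closed[OF vs(1) pre_matchedD(1)[OF M]]
    and clB = fd_subspace_closed[OF vs(2) pre_matchedD(2)[OF M]]
  note cl = pre_matchedD(3-6)[OF M, THEN trilin_closed]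
  have lin: "lin_on (module_prod.scale s t) (module_prod.scale s' t') (?A \<times> ?B) h"
    and bij: "bij_betw h (?A \<times> ?B) (?A' \<times> ?B')"
    and img: "h ` (?A \<times> {0}) = ?A' \<times> {0}" "h ` ({0} \<times> ?B) = {0} \<times> ?B'"
    and hom: "\<And>p q r. p \<in> ?A \<times> ?B \<Longrightarrow> q \<in> ?A \<times> ?B \<Longrightarrow> r \<in> ?A \<times> ?B \<Longrightarrow>
      h (br (alg (double M)) p q r) = br (alg (double M')) (h p) (h q) (h r)"
    using iso unfolding twilled_iso_def Let_def double_sel by blast+
  have hf: "h (x, 0) = (f x, 0)" and inA: "f x \<in> ?A'" if "x \<in> ?A" for x
  proof -
    have "h (x, 0) \<in> ?A' \<times> {0}" using that img(1) by blast
    then show "h (x, 0) = (f x, 0)" "f x \<in> ?A'" by (auto simp: f_def)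
  qed
  have hg: "h (0, u) = (0, g u)" and inB: "g u \<in> ?B'" if "u \<in> ?B" for u
  proof -
    have "h (0, u) \<in> {0} \<times> ?B'" using that img(2) by blast
    then show "h (0, u) = (0, g u)" "g u \<in> ?B'" by (auto simp: g_def)
  qed
  have "lin_on s s' ?A f"
    unfolding lin_on_def
  proof (intro conjI ballI allI)
    show "f (x + y) = f x + f y" if "x \<in> ?A" "y \<in> ?A" for x y
      using lin_on_add[OF lin, of "(x, 0)" "(y, 0)"] that by (simp add: clA clB hf)
    show "f (s c x) = s' c (f x)" if "x \<in> ?A" for c x
    proof -
      interpret vector_space t by (rule vs)
      show ?thesis
        using lin_on_scale[OF lin, of "(x, 0)" c] that by (simp add: clA clB hf prod_scale vs)
    qed
  qed
  moreover have "lin_on t t' ?B g"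
    unfolding lin_on_def
  proof (intro conjI ballI allI)
    show "g (u + v) = g u + g v" if "u \<in> ?B" "v \<in> ?B" for u v
      using lin_on_add[OF lin, of "(0, u)" "(0, v)"] that by (simp add: clA clB hg)
    show "g (t c u) = t' c (g u)" if "u \<in> ?B" for c u
    proof -
      interpret vector_space s by (rule vs)
      show ?thesis
        using lin_on_scale[OF lin, of "(0, u)" c] that by (simp add: clA clB hg prod_scale vs)
    qed
  qed
  moreover have "bij_betw f ?A ?A'"
  proof (rule bij_betw_imageI)
    show "inj_on f ?A"
    proof (rule inj_onI)
      fix x y assume *: "x \<in> ?A" "y \<in> ?A" "f x = f y"
      then have "h (x, 0) = h (y, 0)" by (simp add: hf)
      then show "x = y" using * clB(1) bij by (auto simp: bij_betw_def dest!: inj_onD)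
    qed
    have "f ` ?A = fst ` h ` (?A \<times> {0})" by (force simp: f_def)
    then show "f ` ?A = ?A'" unfolding img by force
  qed
  moreover have "bij_betw g ?B ?B'"
  proof (rule bij_betw_imageI)
    show "inj_on g ?B"
    proof (rule inj_onI)
      fix x y assume *: "x \<in> ?B" "y \<in> ?B" "g x = g y"
      then have "h (0, x) = h (0, y)" by (simp add: hg)
      then show "x = y" using * clA(1) bij by (auto simp: bij_betw_def dest!: inj_onD)
    qed
    have "g ` ?B = snd ` h ` ({0} \<times> ?B)" by (force simp: g_def)
    then show "g ` ?B = ?B'" unfolding img by force
  qed
  moreover note pure = double_br_pure[OF vs(1,2) M] and pure' = double_br_pure[OF vs(3,4) M']
  have "f (br (alg1 M) x y z) = br (alg1 M') (f x) (f y) (f z)" if "x \<in> ?A" "y \<in> ?A" "z \<in> ?A" for x y z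
    using hom[of "(x, 0)" "(y, 0)" "(z, 0)"] that
    by (simp add: pure pure' hf inA cl clA clB)
  moreover have "g (br (alg2 M) u v w) = br (alg2 M') (g u) (g v) (g w)" if "u \<in> ?B" "v \<in> ?B" "w \<in> ?B" for u v w
    using hom[of "(0, u)" "(0, v)" "(0, w)"] that
    by (simp add: pure pure' hg inB cl clA clB)
  moreover have "g (rho M x y u) = rho M' (f x) (f y) (g u)" if "x \<in> ?A" "y \<in> ?A" "u \<in> ?B" for x y u
    using hom[of "(x, 0)" "(y, 0)" "(0, u)"] that
    by (simp add: pure pure' hf hg inA inB cl clA clB)
  moreover have "f (mu M u v x) = mu M' (g u) (g v) (f x)" if "u \<in> ?B" "v \<in> ?B" "x \<in> ?A" for u v x
    using hom[of "(0, u)" "(0, v)" "(x, 0)"] that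
    by (simp add: pure pure' hf hg inA inB cl clA clB)
  ultimately show ?thesis
    unfolding matched_pair_iso_def Let_def f_def[symmetric] g_def[symmetric] by blast
qed

theorem proposition3p10:
  fixes s1 :: "'k::{alg_closed_field, field_char_0} \<Rightarrow> 'a::ab_group_add \<Rightarrow> 'a"
    and s2 :: "'k \<Rightarrow> 'b::ab_group_add \<Rightarrow> 'b"
    and s3 :: "'k \<Rightarrow> 'c::ab_group_add \<Rightarrow> 'c"
    and s4 :: "'k \<Rightarrow> 'd::ab_group_add \<Rightarrow> 'd"
  assumes "vector_space s1" and "vector_space s2" and "vector_space s3" and "vector_space s4"
  shows
    "bij_betw double
       {M. matched_pair s1 s2 M}
       {T. strict_twilled (module_prod.scale s1 s2) T \<and>
           (\<exists>A B. part1 T = A \<times> {0} \<and> part2 T = {0} \<times> B)} \<and>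
     bij_betw split_pair
       {T. strict_twilled s3 T}
       {M. matched_pair s3 s3 M \<and> sp (alg1 M) \<inter> sp (alg2 M) = {0}} \<and>
     (\<forall>M. matched_pair s1 s2 M \<longrightarrow>
       matched_pair_iso s1 s2 (module_prod.scale s1 s2) (module_prod.scale s1 s2)
         (\<lambda>x. (x, 0)) (\<lambda>u. (0, u)) M (split_pair (double M))) \<and>
     (\<forall>T. strict_twilled s3 T \<longrightarrow>
       twilled_iso (module_prod.scale s3 s3) s3 (\<lambda>(x, u). x + u) (double (split_pair T)) T) \<and>
     (\<forall>M M'. matched_pair s1 s2 M \<longrightarrow> matched_pair s3 s4 M' \<longrightarrow>
       ((\<exists>f g. matched_pair_iso s1 s2 s3 s4 f g M M') \<longleftrightarrow>
        (\<exists>h. twilled_iso (module_prod.scale s1 s2) (module_prod.scale s3 s4) h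
               (double M) (double M'))))"
proof (intro conjI allI impI)
  note vs = assms
  show "bij_betw double {M. matched_pair s1 s2 M}
      {T. strict_twilled (module_prod.scale s1 s2) T \<and>
        (\<exists>A B. part1 T = A \<times> {0} \<and> part2 T = {0} \<times> B)}"
  proof (rule bij_betw_imageI)
    show "inj_on double {M. matched_pair s1 s2 M}"
      by (rule inj_onI, rule double_inj[OF vs(1,2)]) (simp_all add: matched_pair_pre)
    show "double ` {M. matched_pair s1 s2 M} =
        {T. strict_twilled (module_prod.scale s1 s2) T \<and>
          (\<exists>A B. part1 T = A \<times> {0} \<and> part2 T = {0} \<times> B)}"
      using strict_twilled_double[OF vs(1,2)] double_surj[OF vs(1,2)]
      by (fastforce simp: double_sel)
  qed
  show "bij_betw split_pair {T. strict_twilled s3 T}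
      {M. matched_pair s3 s3 M \<and> sp (alg1 M) \<inter> sp (alg2 M) = {0}}"
  proof (rule bij_betw_imageI)
    show "inj_on split_pair {T. strict_twilled s3 T}"
      by (rule inj_onI, rule split_pair_inj[OF vs(3)]) (simp_all add: strict_twilled_pre[OF vs(3)])
    show "split_pair ` {T. strict_twilled s3 T} =
        {M. matched_pair s3 s3 M \<and> sp (alg1 M) \<inter> sp (alg2 M) = {0}}"
      using matched_pair_split_pair[OF vs(3)] split_pair_surj[OF vs(3)] by blast
  qed
  show "matched_pair_iso s1 s2 (module_prod.scale s1 s2) (module_prod.scale s1 s2)
      (\<lambda>x. (x, 0)) (\<lambda>u. (0, u)) M (split_pair (double M))" if "matched_pair s1 s2 M" for M
    by (rule matched_pair_iso_split_double[OF vs(1,2) matched_pair_pre[OF that]])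
  show "twilled_iso (module_prod.scale s3 s3) s3 (\<lambda>(x, u). x + u) (double (split_pair T)) T"
    if "strict_twilled s3 T" for T
    by (rule twilled_iso_double_split[OF vs(3) strict_twilled_pre[OF vs(3) that]])
  show "(\<exists>f g. matched_pair_iso s1 s2 s3 s4 f g M M') \<longleftrightarrow>
      (\<exists>h. twilled_iso (module_prod.scale s1 s2) (module_prod.scale s3 s4) h (double M) (double M'))"
    if "matched_pair s1 s2 M" "matched_pair s3 s4 M'" for M M'
    using twilled_iso_of_matched_pair_iso[OF vs matched_pair_pre[OF that(1)]]
      matched_pair_iso_of_twilled_iso[OF vs that[THEN matched_pair_pre]]
    by blast
qed

end
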